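(* Fix $T_0>0$. Let $T_0\le T<\tilde T$, let $g\in C^2[0,\tilde T]$ with $g\ge c_g>0$, let $u_0\in L^2(\Omega)$ and $\psi,\tilde\psi\in L^2(\Omega)$, and let $u,\tilde u$ be the solutions of problem (P) with initial data $u_0$ and sources $g(t)\psi(x)$, $g(t)\tilde\psi(x)$ respectively. Then there is a constant $c>0$, depending on $\alpha,\Omega,q,T_0,c_g$ and $\|g\|_{C^2[0,\tilde T]}$ but not otherwise on $T,\tilde T,\psi,\tilde\psi,u_0$, such that $$\|\psi-\tilde\psi\|_{L^2(\Omega)}\le c\Big(\|A(u(T)-\tilde u(\tilde T))\|_{L^2(\Omega)}+|T-\tilde T|\,T^{-1-\alpha}\|u_0\|_{L^2(\Omega)}+|T-\tilde T|(1+T^{-1}+T)\|\tilde\psi\|_{L^2(\Omega)}\Big).$$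
   Context: Let $\Omega\subset\mathbb{R}^d$ ($d=1,2,3$) be an open bounded smooth domain, $\alpha\in(0,1)$, and $q\in L^\infty(\Omega)$, $q\ge0$, a fixed known potential. Let $A=-\Delta+q$ with zero Dirichlet boundary condition on $L^2(\Omega)$, with eigenvalues $0<\lambda_1\le\lambda_2\le\dots\to\infty$ and $L^2$-orthonormal eigenfunctions $\{\varphi_n\}$. $E_{\alpha,\beta}(z)=\sum_{k\ge0}z^k/\Gamma(k\alpha+\beta)$; $F(t)v=\sum_nE_{\alpha,1}(-\lambda_nt^\alpha)(v,\varphi_n)\varphi_n$, $E(t)v=\sum_nt^{\alpha-1}E_{\alpha,\alpha}(-\lambda_nt^\alpha)(v,\varphi_n)\varphi_n$. Problem (P) is $\partial_t^\alpha u-\Delta u+qu=f$ in $\Omega\times(0,\infty)$, $u=0$ on $\partial\Omega$, $u(0)=u_0$, with the Caputo derivative of order $\alpha$; its solution is $u(t)=F(t)u_0+\int_0^tE(t-s)f(s)\,ds$. *)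

theory Defs
  imports "HOL-Analysis.Analysis"
begin

text \<open>Abstract spectral model of L^2(Omega) and of A = -Delta + q (Dirichlet):
  a real Hilbert space 'h with a complete orthonormal system phi n of eigenfunctions
  and eigenvalues lam n, with 0 < lam 0 \<le> lam 1 \<le> ... \<rightarrow> \<infinity>.\<close>

definition spectral_data :: "(nat \<Rightarrow> 'h::{real_inner,complete_space}) \<Rightarrow> (nat \<Rightarrow> real) \<Rightarrow> bool" where
  "spectral_data phi lam \<longleftrightarrow>
     (\<forall>m n. inner (phi m) (phi n) = (if m = n then 1 else 0)) \<and>
     (\<forall>v. (\<forall>n. inner v (phi n) = 0) \<longrightarrow> v = 0) \<and>
     0 < lam 0 \<and> mono lam \<and> filterlim lam at_top sequentially"

definition mittag_leffler :: "real \<Rightarrow> real \<Rightarrow> real \<Rightarrow> real" where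
  "mittag_leffler a b z = (\<Sum>k. z ^ k / Gamma (real k * a + b))"

definition solF :: "(nat \<Rightarrow> 'h::{real_inner,complete_space}) \<Rightarrow> (nat \<Rightarrow> real) \<Rightarrow> real \<Rightarrow> real \<Rightarrow> 'h \<Rightarrow> 'h" where
  "solF phi lam a t v = (\<Sum>n. (mittag_leffler a 1 (- lam n * t powr a) * inner v (phi n)) *\<^sub>R phi n)"

definition solE :: "(nat \<Rightarrow> 'h::{real_inner,complete_space}) \<Rightarrow> (nat \<Rightarrow> real) \<Rightarrow> real \<Rightarrow> real \<Rightarrow> 'h \<Rightarrow> 'h" where
  "solE phi lam a t v = (\<Sum>n. (t powr (a - 1) * mittag_leffler a a (- lam n * t powr a) * inner v (phi n)) *\<^sub>R phi n)"

definition solP :: "(nat \<Rightarrow> 'h::{real_inner,complete_space}) \<Rightarrow> (nat \<Rightarrow> real) \<Rightarrow> real \<Rightarrow> 'h \<Rightarrow> (real \<Rightarrow> 'h) \<Rightarrow> real \<Rightarrow> 'h" where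
  "solP phi lam a u0 f t = solF phi lam a t u0 + integral {0..t} (\<lambda>s. solE phi lam a (t - s) (f s))"

definition opA :: "(nat \<Rightarrow> 'h::{real_inner,complete_space}) \<Rightarrow> (nat \<Rightarrow> real) \<Rightarrow> 'h \<Rightarrow> 'h" where
  "opA phi lam v = (\<Sum>n. (lam n * inner v (phi n)) *\<^sub>R phi n)"

definition domA :: "(nat \<Rightarrow> 'h::{real_inner,complete_space}) \<Rightarrow> (nat \<Rightarrow> real) \<Rightarrow> 'h set" where
  "domA phi lam = {v. summable (\<lambda>n. (lam n * inner v (phi n))\<^sup>2)}"

definition C2_bounded :: "real \<Rightarrow> real \<Rightarrow> (real \<Rightarrow> real) \<Rightarrow> bool" where
  "C2_bounded T' M g \<longleftrightarrow> (\<exists>g1 g2.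
     (\<forall>t\<in>{0..T'}. (g has_real_derivative g1 t) (at t within {0..T'})) \<and>
     (\<forall>t\<in>{0..T'}. (g1 has_real_derivative g2 t) (at t within {0..T'})) \<and>
     continuous_on {0..T'} g2 \<and>
     (\<forall>t\<in>{0..T'}. \<bar>g t\<bar> \<le> M \<and> \<bar>g1 t\<bar> \<le> M \<and> \<bar>g2 t\<bar> \<le> M))"

end

theory Submission
  imports Defs
begin

text \<open>
  In the eigenbasis the problem decouples into scalar modes. Write \<open>e(t)\<close> for
  \<open>mittag_leffler a 1 (- lam n * t powr a)\<close>, \<open>k(t)\<close> for the \<open>n\<close>-th coefficient of \<open>solE\<close>, so
  that \<open>e' = - lam n * k\<close>, and \<open>G(t)\<close> for the convolution of \<open>k\<close> with \<open>g\<close>. The \<open>n\<close>-th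
  coefficient of \<open>u(T) - u'(T')\<close> is \<open>(e(T) - e(T')) u0 + G(T) psi - G(T') psi'\<close>, which is solved for
  \<open>psi - psi'\<close>. If \<open>k \<ge> 0\<close>, then \<open>lam n * G(T) \<ge> cg (1 - e(T))\<close> is bounded away from zero, while
  the decay \<open>k(t) = O(t powr (- 1 - a) / (lam n)\<^sup>2)\<close> bounds the differences of \<open>e\<close> and \<open>G\<close>.
  Parseval's identity then sums the modes.

  It remains to see that \<open>mittag_leffler a b (- x)\<close> is nonnegative and decreasing for \<open>b \<ge> a\<close>,
  \<open>x \<ge> 0\<close>. It is the limit of the rescaled Taylor coefficients of
  \<open>(1 - z) powr (a - b) / ((1 - z) powr a + mu)\<close> with \<open>mu = x * n powr - a\<close>. As all coefficients of
  \<open>(1 - z) powr a\<close> except the constant one are negative, these Taylor coefficients satisfy a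
  recursion from which nonnegativity and monotonicity in \<open>mu\<close> are immediate. The decay follows since
  \<open>x * mittag_leffler a 2 (- x) = 1 / Gamma (2 - a) - mittag_leffler a (2 - a) (- x)\<close> is bounded and
  dominates \<open>x * mittag_leffler a 1 (- x)\<close>, whose second factor has derivative
  \<open>- mittag_leffler a a (- x) / a\<close>, which is monotone.
\<close>

section \<open>Monotonicity of the Mittag-Leffler function\<close>

text \<open>The coefficient of \<open>z ^ n\<close> in \<open>(1 - z) powr - b\<close>.\<close>

definition neg_binom :: "real \<Rightarrow> nat \<Rightarrow> real" where
  "neg_binom b n = pochhammer b n / fact n"

text \<open>Vandermonde convolution: comparison of coefficients when the binomial series with
  exponents \<open>- x\<close> and \<open>- y\<close> are multiplied.\<close>

lemma neg_binom_add: "neg_binom (x + y) n = (\<Sum>i\<le>n. neg_binom x i * neg_binom y (n - i))"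
  unfolding neg_binom_def pochhammer_binomial_sum sum_divide_distrib
  by (intro sum.cong refl) (simp add: binomial_fact)

lemma neg_binom_nonneg: "0 \<le> b \<Longrightarrow> 0 \<le> neg_binom b n"
  by (simp add: neg_binom_def pochhammer_nonneg pochhammer_prod prod_nonneg)

text \<open>Only the leading factor \<open>- a\<close> of \<open>pochhammer (- a) (Suc i)\<close> is
  negative; the others form \<open>pochhammer (1 - a) i\<close>.\<close>

lemma neg_binom_minus_Suc_nonpos:
  assumes "0 < a" "a < 1"
  shows "neg_binom (- a) (Suc i) \<le> 0"
proof -
  have "0 \<le> pochhammer (1 - a) i" using assms by (simp add: pochhammer_prod prod_nonneg)
  moreover have "pochhammer (- a) (Suc i) = - a * pochhammer (1 - a) i"
    by (simp add: pochhammer_rec algebra_simps)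
  ultimately show ?thesis using assms
    by (simp add: neg_binom_def divide_nonpos_pos)
qed

text \<open>As a function of \<open>j\<close> the coefficient is a polynomial, so the series
  converges on the unit disc. The induction multiplies by \<open>(j * a + b + n) / (n + 1)\<close>,
  where the factor \<open>j\<close> amounts to termwise differentiation.\<close>

lemma summable_neg_binom:
  assumes "norm (x::real) < 1"
  shows "summable (\<lambda>j. neg_binom (real j * a + b) n * x ^ j)"
  using assms
proof (induction n arbitrary: x)
  case 0
  then show ?case by (simp add: neg_binom_def summable_geometric)
next
  case (Suc n)
  define c where "c j = neg_binom (real j * a + b) n" for j
  have "summable (\<lambda>j. diffs c j * x ^ j)"
    by (rule termdiff_converges[of x 1]) (use Suc in \<open>auto simp: c_def\<close>)
  then have "summable (\<lambda>j. real (Suc j) * c (Suc j) * x ^ j * x)"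
    unfolding diffs_def by (intro summable_mult2) (simp add: mult_ac)
  then have "summable (\<lambda>j. real (Suc j) * c (Suc j) * x ^ Suc j)"
    by (simp add: mult_ac)
  then have 1: "summable (\<lambda>j. real j * c j * x ^ j)"
    by (subst (asm) summable_Suc_iff)
  have 2: "summable (\<lambda>j. c j * x ^ j)"
    using Suc unfolding c_def by auto
  have "summable (\<lambda>j. (a * (real j * c j * x ^ j) + (b + n) * (c j * x ^ j)) / (n + 1))"
    by (intro summable_divide summable_add summable_mult 1 2)
  moreover have "(a * (real j * c j * x ^ j) + (b + n) * (c j * x ^ j)) / (n + 1)
      = neg_binom (real j * a + b) (Suc n) * x ^ j" for j
    by (simp add: c_def neg_binom_def pochhammer_Suc field_simps)
  ultimately show ?case by (simp only:)
qed

text \<open>The coefficient of \<open>z ^ n\<close> in \<open>(1 - z) powr (a - b) / ((1 - z) powr a + mu)\<close>; the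
  Laplace transform of \<open>t powr (b - 1) * mittag_leffler a b (- mu * t powr a)\<close> is obtained by
  putting \<open>s\<close> in place of \<open>1 - z\<close>.\<close>

definition ml_coeff :: "real \<Rightarrow> real \<Rightarrow> real \<Rightarrow> nat \<Rightarrow> real" where
  "ml_coeff a b mu n = (\<Sum>j. neg_binom (real j * a + b) n * (- mu) ^ j)"

text \<open>Coefficient of \<open>z ^ n\<close> in
  \<open>((1 - z) powr a + mu) * Q = (1 - z) powr (a - b)\<close>, where \<open>Q\<close> has the
  coefficients \<open>ml_coeff a b mu\<close>. The constant coefficient 1 of
  \<open>(1 - z) powr a\<close> joins \<open>mu\<close> in the factor \<open>1 + mu\<close>.\<close>

lemma ml_coeff_rec:
  assumes "0 \<le> mu" "mu < 1"
  shows "(1 + mu) * ml_coeff a b mu n =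
    neg_binom (b - a) n + (\<Sum>i<n. - neg_binom (- a) (Suc i) * ml_coeff a b mu (n - Suc i))"
proof -
  have mu: "norm (- mu) < 1" using assms by simp
  note sm = summable_neg_binom[OF mu]
  have "(\<Sum>i\<le>n. neg_binom (- a) i * ml_coeff a b mu (n - i))
      = (\<Sum>i\<le>n. \<Sum>j. neg_binom (- a) i * (neg_binom (real j * a + b) (n - i) * (- mu) ^ j))"
    unfolding ml_coeff_def by (intro sum.cong refl suminf_mult[symmetric] sm)
  also have "\<dots> = (\<Sum>j. \<Sum>i\<le>n. neg_binom (- a) i * (neg_binom (real j * a + b) (n - i) * (- mu) ^ j))"
    by (rule suminf_sum[symmetric]) (intro summable_mult sm)
  also have "\<dots> = (\<Sum>j. neg_binom (real j * a + (b - a)) n * (- mu) ^ j)"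
  proof (intro suminf_cong)
    fix j
    have "neg_binom (real j * a + (b - a)) n = neg_binom (- a + (real j * a + b)) n"
      by (simp add: algebra_simps)
    also have "\<dots> = (\<Sum>i\<le>n. neg_binom (- a) i * neg_binom (real j * a + b) (n - i))"
      by (rule neg_binom_add)
    finally show "(\<Sum>i\<le>n. neg_binom (- a) i * (neg_binom (real j * a + b) (n - i) * (- mu) ^ j))
      = neg_binom (real j * a + (b - a)) n * (- mu) ^ j"
      by (simp add: sum_distrib_right mult.assoc)
  qed
  \<comment> \<open>The term \<open>j = 0\<close> is the right-hand side of the generating identity;
    from the others one factor \<open>- mu\<close> splits off, and the shift by \<open>a\<close>
    turns \<open>b - a\<close> back into \<open>b\<close>.\<close>
  also have "\<dots> = neg_binom (b - a) n + (\<Sum>j. neg_binom (real (Suc j) * a + (b - a)) n * (- mu) ^ Suc j)"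
    by (subst suminf_split_head[OF sm]) simp
  also have "(\<Sum>j. neg_binom (real (Suc j) * a + (b - a)) n * (- mu) ^ Suc j) = - mu * ml_coeff a b mu n"
    unfolding ml_coeff_def
    by (subst suminf_mult[OF sm, symmetric]) (simp add: algebra_simps)
  finally have "(\<Sum>i\<le>n. neg_binom (- a) i * ml_coeff a b mu (n - i))
      = neg_binom (b - a) n - mu * ml_coeff a b mu n" by simp
  moreover have "(\<Sum>i\<le>n. neg_binom (- a) i * ml_coeff a b mu (n - i))
     = ml_coeff a b mu n + (\<Sum>i<n. neg_binom (- a) (Suc i) * ml_coeff a b mu (n - Suc i))"
    by (subst sum.atMost_shift) (simp add: neg_binom_def)
  ultimately show ?thesis by (simp add: algebra_simps sum_negf)
qed

text \<open>Strong induction: every term on the right of the recursion is nonnegative, the first one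
  because \<open>b - a \<ge> 0\<close>.\<close>

lemma ml_coeff_nonneg:
  assumes a: "0 < a" "a < 1" "a \<le> b" and mu: "0 \<le> mu" "mu < 1"
  shows "0 \<le> ml_coeff a b mu n"
proof (induction n rule: less_induct)
  case (less n)
  have "0 \<le> neg_binom (b - a) n + (\<Sum>i<n. - neg_binom (- a) (Suc i) * ml_coeff a b mu (n - Suc i))"
    using a less neg_binom_minus_Suc_nonpos[OF a(1,2)]
    by (intro add_nonneg_nonneg neg_binom_nonneg sum_nonneg mult_nonneg_nonneg) auto
  then have "0 \<le> (1 + mu) * ml_coeff a b mu n"
    by (simp only: ml_coeff_rec[OF mu])
  then show ?case using mu by (simp add: zero_le_mult_iff)
qed

text \<open>The right-hand side of the recursion depends on the parameter only through earlier
  coefficients, which are ordered by induction; by nonnegativity, lowering \<open>1 + nu\<close> to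
  \<open>1 + mu\<close> on the left goes the right way.\<close>

lemma ml_coeff_antimono:
  assumes a: "0 < a" "a < 1" "a \<le> b" and mu: "0 \<le> mu" "mu \<le> nu" "nu < 1"
  shows "ml_coeff a b nu n \<le> ml_coeff a b mu n"
proof (induction n rule: less_induct)
  case (less n)
  have mu': "mu < 1" and nu: "0 \<le> nu" using mu by auto
  have "(1 + mu) * ml_coeff a b nu n \<le> (1 + nu) * ml_coeff a b nu n"
    using mu ml_coeff_nonneg[OF a nu mu(3)] by (intro mult_right_mono) auto
  also have "\<dots> \<le> (1 + mu) * ml_coeff a b mu n"
    unfolding ml_coeff_rec[OF mu(1) mu'] ml_coeff_rec[OF nu mu(3)]
    using less neg_binom_minus_Suc_nonpos[OF a(1,2)]
    by (intro add_left_mono sum_mono mult_left_mono) auto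
  finally show ?case using mu(1) by simp
qed

section \<open>Growth of binomial coefficients and convergence to the Mittag-Leffler series\<close>

lemma neg_binom_le_exp:
  assumes "0 < b" "0 < n"
  shows "neg_binom b n \<le> exp b * real n powr (b - 1)"
proof -
  have "neg_binom b n = (\<Prod>i<n. 1 + (b - 1) / real (Suc i))"
    unfolding neg_binom_def pochhammer_prod fact_prod_Suc
    by (simp add: prod_dividef[symmetric] atLeast0LessThan field_simps)
  also have "\<dots> \<le> (\<Prod>i<n. exp ((b - 1) / real (Suc i)))"
  proof (intro prod_mono conjI)
    fix i assume "i \<in> {..<n}"
    show "0 \<le> 1 + (b - 1) / real (Suc i)" using assms by (simp add: field_simps)
    show "1 + (b - 1) / real (Suc i) \<le> exp ((b - 1) / real (Suc i))" by (rule exp_ge_add_one_self)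
  qed
  also have "\<dots> = exp ((b - 1) * harm n)"
    by (simp add: exp_sum[symmetric] harm_altdef sum_distrib_left divide_inverse)
  \<comment> \<open>The sign of \<open>b - 1\<close> decides which side of
    \<open>ln n \<le> harm n \<le> 1 + ln n\<close> is used; the additive 1 costs at most a factor
    \<open>exp b\<close>.\<close>
  also have "\<dots> \<le> exp (b + (b - 1) * ln n)"
  proof -
    have lo: "ln n \<le> harm n"
      using ln_le_harm[of n] assms(2) by (smt (verit) ln_le_cancel_iff of_nat_0_less_iff)
    obtain m where m: "n = Suc m" using assms(2) gr0_implies_Suc by blast
    have hi: "harm n \<le> 1 + ln n"
      using decseqD[OF decseq_harm_diff_ln, of 0 m] by (simp add: m harm_expand)
    show ?thesis
    proof (cases "b \<ge> 1")
      case True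
      then have "(b - 1) * harm n \<le> (b - 1) * (1 + ln n)" using hi by (intro mult_left_mono) auto
      then show ?thesis by (simp add: algebra_simps)
    next
      case False
      then have "(b - 1) * harm n \<le> (b - 1) * ln n" using lo by (intro mult_left_mono_neg) auto
      then show ?thesis using assms by simp
    qed
  qed
  finally show ?thesis using assms by (simp add: powr_def exp_add)
qed

text \<open>Raising \<open>b\<close> by one multiplies the normalised coefficient by \<open>1 / b + 1 / n\<close>, which gives
  arbitrarily fast geometric decay in \<open>b\<close>, uniformly in large \<open>n\<close>.\<close>

lemma neg_binom_le_geometric:
  assumes N: "2 \<le> N" and "N \<le> real n" "0 < b"
  shows "neg_binom b n \<le> exp (N + 1) * (N / 2) powr (N + 1) * (2 / N) powr b * real n powr (b - 1)"
proof -
  define C where "C = exp (N + 1) * (N / 2) powr (N + 1)"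
  have C: "C > 0" using N by (simp add: C_def)
  have n: "real n > 0" "n > 0" using assms by auto
  \<comment> \<open>Induction on \<open>k\<close>, each step enlarging the range of \<open>b\<close>
    by one. The base range ends at \<open>N + 1\<close> so that in the step
    \<open>b - 1 \<ge> N\<close>, hence \<open>1 / (b - 1) + 1 / n \<le> 2 / N\<close>.\<close>
  have "neg_binom b n \<le> C * (2 / N) powr b * real n powr (b - 1)"
    if "0 < b" "b \<le> N + 1 + real k" for k b
    using that
  proof (induction k arbitrary: b)
    case 0
    \<comment> \<open>On the base range the factor \<open>(N / 2) powr (N + 1)\<close> of
      \<open>C\<close> outweighs \<open>(2 / N) powr b\<close>, so the crude exponential bound
      suffices.\<close>
    have "1 \<le> (N / 2) powr (N + 1 - b)" using 0 N by (intro ge_one_powr_ge_zero) auto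
    also have "\<dots> = (N / 2) powr (N + 1) * (2 / N) powr b"
      using N by (simp add: powr_diff powr_divide)
    finally have "exp b * 1 \<le> exp (N + 1) * ((N / 2) powr (N + 1) * (2 / N) powr b)"
      using 0 by (intro mult_mono) auto
    then have "exp b * real n powr (b - 1) \<le> C * (2 / N) powr b * real n powr (b - 1)"
      by (intro mult_right_mono) (auto simp: C_def mult.assoc)
    with neg_binom_le_exp[OF 0(1) n(2)] show ?case by linarith
  next
    case (Suc k)
    show ?case
    proof (cases "b \<le> N + 1 + real k")
      case True
      then show ?thesis using Suc by blast
    next
      case False
      define c where "c = b - 1"
      have c: "c \<ge> N" "c > 0" "c \<le> N + 1 + real k" using False Suc N by (auto simp: c_def)
      have "pochhammer c (Suc n) = c * pochhammer b n"
        by (simp add: pochhammer_rec c_def)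
      moreover have "pochhammer c (Suc n) = (c + n) * pochhammer c n"
        by (rule pochhammer_rec')
      ultimately have "pochhammer b n = pochhammer c n * ((c + n) / c)"
        using c by (simp add: field_simps)
      also have "(c + n) / c = (1 / c + 1 / n) * n" using c n by (simp add: field_simps)
      finally have "neg_binom b n = neg_binom c n * ((1 / c + 1 / n) * n)"
        by (simp add: neg_binom_def)
      also have "\<dots> \<le> (C * (2 / N) powr c * real n powr (c - 1)) * ((1 / N + 1 / N) * n)"
        using Suc.IH[OF c(2,3)] c N C assms n
        by (intro mult_mono mult_nonneg_nonneg add_mono divide_left_mono) auto
      also have "\<dots> = C * (2 / N) powr b * real n powr (b - 1)"
        using N n by (simp add: c_def powr_diff power2_eq_square)
      finally show ?thesis .
    qed
  qed
  from this[OF assms(3), of "nat \<lceil>b\<rceil>"] show ?thesis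
    using N by (simp add: C_def) linarith
qed

text \<open>The product formula for the reciprocal Gamma function has one more Pochhammer factor
  than \<open>neg_binom\<close>, which accounts for a quotient \<open>n / (b + n)\<close> tending to
  1.\<close>

lemma neg_binom_tendsto_rGamma:
  "(\<lambda>n. neg_binom b n / real n powr (b - 1)) \<longlonglongrightarrow> rGamma b"
proof -
  have "(\<lambda>n. rGamma_series b n * (real n / (b + real n))) \<longlonglongrightarrow> rGamma b * 1"
  proof (intro tendsto_mult rGamma_series_LIMSEQ)
    have "filterlim (\<lambda>n. b + real n) at_infinity sequentially"
      by (rule filterlim_at_infinity_imp_norm_at_top[THEN filterlim_norm_at_top_imp_at_infinity])
         (intro filterlim_at_top_imp_at_infinity filterlim_tendsto_add_at_top[OF tendsto_const] filterlim_real_sequentially)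
    then have "(\<lambda>n. 1 - b / (b + real n)) \<longlonglongrightarrow> 1 - 0"
      by (intro tendsto_diff tendsto_const tendsto_divide_0[OF tendsto_const])
    moreover have "eventually (\<lambda>n. 1 - b / (b + real n) = real n / (b + real n)) sequentially"
      using eventually_gt_at_top[of "nat \<lceil>\<bar>b\<bar>\<rceil>"]
    proof eventually_elim
      case (elim n)
      then have "b + real n \<noteq> 0" by linarith
      then show ?case by (simp add: field_simps)
    qed
    ultimately show "(\<lambda>n. real n / (b + real n)) \<longlonglongrightarrow> 1"
      by (simp add: tendsto_cong)
  qed
  moreover have "eventually (\<lambda>n. rGamma_series b n * (real n / (b + real n)) = neg_binom b n / real n powr (b - 1)) sequentially"
    using eventually_gt_at_top[of "nat \<lceil>\<bar>b\<bar>\<rceil>"]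
  proof eventually_elim
    case (elim n)
    then have n: "n > 0" "b + real n > 0" by linarith+
    have "rGamma_series b n = pochhammer b n * (b + real n) / (fact n * real n powr b)"
      using n by (simp add: rGamma_series_def pochhammer_Suc powr_def)
    then have "rGamma_series b n * (real n / (b + real n)) = pochhammer b n * real n / (fact n * real n powr b)"
      using n by simp
    then show ?case using n by (simp add: neg_binom_def powr_diff)
  qed
  ultimately show ?thesis by (simp add: tendsto_cong)
qed

text \<open>The rescaled parameter eventually enters the range \<open>mu < 1\<close> in which the
  recursion holds.\<close>

lemma eventually_ml_step_lt_1:
  assumes "0 < a"
  shows "eventually (\<lambda>n. x * real n powr - a < 1) sequentially"
proof -
  have "((\<lambda>n. x * real n powr - a) \<longlongrightarrow> x * 0) sequentially"
    using assms by (intro tendsto_intros tendsto_neg_powr filterlim_real_sequentially) auto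
  then show ?thesis by (rule order_tendstoD) simp
qed

text \<open>Termwise, \<open>neg_binom (k * a + b) n\<close> behaves like
  \<open>n powr (k * a + b - 1) / Gamma (k * a + b)\<close>, and the powers of \<open>n\<close>
  cancel against \<open>mu ^ k\<close> and the normalisation. Tannery's theorem permits the termwise
  limit and also yields absolute summability of the limit series.\<close>

lemma
  assumes a: "0 < a" and b: "0 < b" and x: "0 \<le> x"
  shows ml_coeff_tendsto:
    "(\<lambda>n. ml_coeff a b (x * real n powr - a) n / real n powr (b - 1)) \<longlonglongrightarrow> mittag_leffler a b (- x)"
  and summable_mittag_leffler_nonneg: "summable (\<lambda>k. x ^ k / Gamma (real k * a + b))"
proof -
  have pos: "real k * a + b > 0" for k using a b by (simp add: add_nonneg_pos)
  \<comment> \<open>\<open>N\<close> is chosen so large that the geometric majorant below has ratio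
    less than 1.\<close>
  obtain N :: real where N: "N \<ge> 2" "x * (2 / N) powr a < 1"
  proof -
    have "eventually (\<lambda>n. 2 \<le> n \<and> x * 2 powr a * real n powr - a < 1) sequentially"
      by (intro eventually_conj eventually_ge_at_top eventually_ml_step_lt_1 a)
    then obtain n where "2 \<le> n" "x * 2 powr a * real n powr - a < 1"
      using eventually_happens' sequentially_bot by blast
    then show ?thesis
      by (intro that[of "real n"]) (auto simp: powr_divide powr_minus_divide)
  qed
  define C where "C = exp (N + 1) * (N / 2) powr (N + 1) * (2 / N) powr b"
  define f where "f k n = neg_binom (real k * a + b) n * (- (x * real n powr - a)) ^ k / real n powr (b - 1)" for k n
  have lim: "(\<lambda>n. f k n) \<longlonglongrightarrow> (- x) ^ k / Gamma (real k * a + b)" for k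
  proof -
    have "(\<lambda>n. (- x) ^ k * (neg_binom (real k * a + b) n / real n powr (real k * a + b - 1)))
         \<longlonglongrightarrow> (- x) ^ k * rGamma (real k * a + b)"
      by (intro tendsto_intros neg_binom_tendsto_rGamma)
    moreover have "eventually (\<lambda>n. (- x) ^ k * (neg_binom (real k * a + b) n / real n powr (real k * a + b - 1)) = f k n) sequentially"
      using eventually_gt_at_top[of 0]
    proof eventually_elim
      case (elim n)
      have "(- (x * real n powr - a)) ^ k = (- x) ^ k * (real n powr - a) ^ k"
        by (simp flip: power_mult_distrib)
      also have "(real n powr - a) ^ k = real n powr (- (real k * a))"
        using elim by (simp add: powr_power mult.commute)
      finally show ?case using elim
        by (simp add: f_def powr_diff powr_add powr_minus field_simps)
    qed
    ultimately show ?thesis by (simp add: tendsto_cong rGamma_inverse_Gamma divide_inverse)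
  qed
  have bound: "norm (f k n) \<le> C * (x * (2 / N) powr a) ^ k" if "real n \<ge> N" for k n
  proof -
    have n: "n > 0" using that N by (cases n) auto
    have "norm (f k n) = neg_binom (real k * a + b) n * (x ^ k * real n powr (- (real k * a))) / real n powr (b - 1)"
      using x n neg_binom_nonneg[OF less_imp_le[OF pos]]
      by (simp add: f_def abs_mult power_abs power_mult_distrib powr_power mult.commute)
    also have "\<dots> \<le> (exp (N + 1) * (N / 2) powr (N + 1) * (2 / N) powr (real k * a + b) * real n powr (real k * a + b - 1))
         * (x ^ k * real n powr (- (real k * a))) / real n powr (b - 1)"
      using x neg_binom_le_geometric[OF N(1) that pos[of k]]
      by (intro divide_right_mono mult_right_mono) auto
    also have "\<dots> = exp (N + 1) * (N / 2) powr (N + 1) * (2 / N) powr (real k * a + b)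
         * (real n powr (real k * a + b - 1) * real n powr (- (real k * a)) / real n powr (b - 1) * x ^ k)"
      by simp
    also have "real n powr (real k * a + b - 1) * real n powr (- (real k * a)) = real n powr (b - 1)"
      by (simp flip: powr_add)
    also have "exp (N + 1) * (N / 2) powr (N + 1) * (2 / N) powr (real k * a + b)
         * (real n powr (b - 1) / real n powr (b - 1) * x ^ k) = C * (x ^ k * (2 / N) powr (real k * a))"
      using n by (simp add: C_def powr_add[of "2 / N"])
    also have "(2 / N) powr (real k * a) = ((2 / N) powr a) ^ k"
      using N by (simp add: powr_power mult.commute)
    finally show ?thesis by (simp add: power_mult_distrib)
  qed
  have sm: "summable (\<lambda>k. C * (x * (2 / N) powr a) ^ k)"
    using N x by (intro summable_mult summable_geometric) auto
  have ev: "eventually (\<lambda>(k,n). norm (f k n) \<le> C * (x * (2 / N) powr a) ^ k) (at_top \<times>\<^sub>F sequentially)"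
  proof -
    have "eventually (\<lambda>n. real n \<ge> N) sequentially"
      using filterlim_real_sequentially by (simp add: filterlim_at_top)
    with bound show ?thesis
      unfolding eventually_prod_filter
      by (intro exI[where x = "\<lambda>_. True", OF exI[where x = "\<lambda>n. N \<le> real n"]]) auto
  qed
  note tan = tannerys_theorem[OF lim ev sm sequentially_bot]
  have "(\<lambda>n. \<Sum>k. f k n) \<longlonglongrightarrow> mittag_leffler a b (- x)"
    using tan unfolding mittag_leffler_def by blast
  moreover have "eventually (\<lambda>n. (\<Sum>k. f k n) = ml_coeff a b (x * real n powr - a) n / real n powr (b - 1)) sequentially"
  proof -
    show ?thesis using eventually_ml_step_lt_1[OF a, of x]
    proof eventually_elim
      case (elim n)
      then have "norm (- (x * real n powr - a)) < 1" using x by simp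
      from suminf_divide[OF summable_neg_binom[OF this]]
      show ?case by (simp add: f_def ml_coeff_def)
    qed
  qed
  ultimately show "(\<lambda>n. ml_coeff a b (x * real n powr - a) n / real n powr (b - 1)) \<longlonglongrightarrow> mittag_leffler a b (- x)"
    by (simp add: tendsto_cong)
  have "summable (\<lambda>k. norm ((- x) ^ k / Gamma (real k * a + b)))" using tan by blast
  moreover have "norm ((- x) ^ k / Gamma (real k * a + b)) = x ^ k / Gamma (real k * a + b)" for k
    using x Gamma_real_pos[OF pos[of k]] by (simp add: power_abs)
  ultimately show "summable (\<lambda>k. x ^ k / Gamma (real k * a + b))" by simp
qed

lemma summable_mittag_leffler:
  assumes "0 < a" "0 < b"
  shows "summable (\<lambda>k. x ^ k / Gamma (real k * a + b))"
proof (rule summable_norm_cancel)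
  have "0 < Gamma (real k * a + b)" for k using assms by (intro Gamma_real_pos) (simp add: add_nonneg_pos)
  then have "norm (x ^ k / Gamma (real k * a + b)) = \<bar>x\<bar> ^ k / Gamma (real k * a + b)" for k
    by (simp add: power_abs less_imp_le abs_of_pos)
  then show "summable (\<lambda>k. norm (x ^ k / Gamma (real k * a + b)))"
    using summable_mittag_leffler_nonneg[OF assms, of "\<bar>x\<bar>"] by simp
qed

section \<open>Sign and monotonicity of the limit\<close>

lemma mittag_leffler_nonneg:
  assumes "0 < a" "a < 1" "a \<le> b" "0 \<le> x"
  shows "0 \<le> mittag_leffler a b (- x)"
proof (rule tendsto_lowerbound[OF ml_coeff_tendsto])
  show "eventually (\<lambda>n. 0 \<le> ml_coeff a b (x * real n powr - a) n / real n powr (b - 1)) sequentially"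
    using eventually_ml_step_lt_1[OF assms(1), of x]
    by eventually_elim (use assms in \<open>auto intro!: divide_nonneg_nonneg ml_coeff_nonneg\<close>)
qed (use assms in auto)

lemma mittag_leffler_antimono:
  assumes "0 < a" "a < 1" "a \<le> b" "0 \<le> x" "x \<le> y"
  shows "mittag_leffler a b (- y) \<le> mittag_leffler a b (- x)"
proof (rule tendsto_le[OF _ ml_coeff_tendsto ml_coeff_tendsto])
  show "eventually (\<lambda>n. ml_coeff a b (y * real n powr - a) n / real n powr (b - 1)
      \<le> ml_coeff a b (x * real n powr - a) n / real n powr (b - 1)) sequentially"
    using eventually_ml_step_lt_1[OF assms(1), of y]
    by eventually_elim (use assms in \<open>auto intro!: divide_right_mono ml_coeff_antimono mult_right_mono\<close>)
qed (use assms in auto)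
section \<open>Decay\<close>

lemma mittag_leffler_zero: "mittag_leffler a b 0 = 1 / Gamma b"
proof -
  have "mittag_leffler a b 0 = (\<Sum>k. 1 / Gamma (real k * a + b) * 0 ^ k)"
    by (simp add: mittag_leffler_def)
  also have "\<dots> = 1 / Gamma b"
    by (subst powser_zero) simp
  finally show ?thesis .
qed

text \<open>Multiplication by \<open>z\<close> shifts the series by one index, so that only the term
  \<open>k = 0\<close> is missing.\<close>

lemma mittag_leffler_shift:
  assumes "0 < a" "0 < b"
  shows "z * mittag_leffler a (b + a) z = mittag_leffler a b z - 1 / Gamma b"
proof -
  have "z * mittag_leffler a (b + a) z = (\<Sum>k. z * (z ^ k / Gamma (real k * a + (b + a))))"
    unfolding mittag_leffler_def using assms
    by (intro suminf_mult[symmetric] summable_mittag_leffler) auto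
  also have "\<dots> = (\<Sum>k. z ^ Suc k / Gamma (real (Suc k) * a + b))"
    by (simp add: algebra_simps)
  finally show ?thesis
    unfolding mittag_leffler_def using suminf_split_head[OF summable_mittag_leffler[OF assms], of z] by simp
qed

lemma mittag_leffler_has_derivative_series:
  assumes "0 < a" "0 < b"
  shows "(mittag_leffler a b has_real_derivative
           (\<Sum>k. diffs (\<lambda>k. 1 / Gamma (real k * a + b)) k * z ^ k)) (at z)"
proof -
  have "mittag_leffler a b = (\<lambda>z. \<Sum>k. 1 / Gamma (real k * a + b) * z ^ k)"
    by (simp add: mittag_leffler_def fun_eq_iff)
  then show ?thesis
    using termdiffs_strong_converges_everywhere[of "\<lambda>k. 1 / Gamma (real k * a + b)" z]
      summable_mittag_leffler[OF assms] by simp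
qed

text \<open>\<open>Gamma (y + 1) = y * Gamma y\<close> at \<open>y = (k + 1) * a\<close> cancels the
  factor \<open>k + 1\<close> of the differentiated series.\<close>

lemma mittag_leffler_one_has_derivative:
  assumes "0 < a"
  shows "(mittag_leffler a 1 has_real_derivative mittag_leffler a a z / a) (at z)"
proof -
  have "diffs (\<lambda>k. 1 / Gamma (real k * a + 1)) k * z ^ k = (z ^ k / Gamma (real k * a + a)) / a" for k
  proof -
    have pos: "real (Suc k) * a > 0" using assms by simp
    then have "Gamma (real (Suc k) * a + 1) = real (Suc k) * a * Gamma (real (Suc k) * a)"
      using Gamma_plus1[of "real (Suc k) * a"] by (metis less_irrefl nonpos_Ints_nonpos not_le)
    then have "diffs (\<lambda>k. 1 / Gamma (real k * a + 1)) k = 1 / (a * Gamma (real (Suc k) * a))"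
      unfolding diffs_def by (simp del: of_nat_Suc)
    also have "real (Suc k) * a = real k * a + a" by (simp add: algebra_simps)
    finally show ?thesis by simp
  qed
  moreover have "mittag_leffler a a z / a = (\<Sum>k. (z ^ k / Gamma (real k * a + a)) / a)"
    unfolding mittag_leffler_def using assms by (intro suminf_divide[symmetric] summable_mittag_leffler)
  ultimately show ?thesis
    using mittag_leffler_has_derivative_series[OF assms zero_less_one, of z] by simp
qed

lemma continuous_on_mittag_leffler_one:
  assumes "0 < a"
  shows "continuous_on S (mittag_leffler a 1)"
  using mittag_leffler_one_has_derivative[OF assms] DERIV_isCont continuous_at_imp_continuous_on by blast

text \<open>From \<open>(k * a + 1) / Gamma (k * a + 2) = 1 / Gamma (k * a + 1)\<close> the left
  function equals the right one plus \<open>a * z\<close> times the derivative \<open>D\<close> of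
  the latter. At \<open>z = - x\<close> this correction is nonpositive, as the function increases on
  the negative axis.\<close>

lemma mittag_leffler_one_le_two:
  assumes a: "0 < a" "a < 1" and x: "0 < x"
  shows "mittag_leffler a 1 (- x) \<le> mittag_leffler a 2 (- x)"
proof -
  define c where "c k = 1 / Gamma (real k * a + 2)" for k
  define D where "D = (\<Sum>k. diffs c k * (- x) ^ k)"
  have der: "(mittag_leffler a 2 has_real_derivative D) (at (- x))"
    unfolding D_def c_def using a by (intro mittag_leffler_has_derivative_series) auto
  \<comment> \<open>Monotonicity is available for nonpositive arguments only, so the sign of
    \<open>D\<close> is read off on the open half-line.\<close>
  have "mono_on {..<0} (mittag_leffler a 2)"
  proof (rule mono_onI)
    fix r s :: real assume "r \<in> {..<0}" "s \<in> {..<0}" "r \<le> s"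
    then show "mittag_leffler a 2 r \<le> mittag_leffler a 2 s"
      using mittag_leffler_antimono[of a 2 "- s" "- r"] a by simp
  qed
  then have D: "D \<ge> 0"
    by (rule mono_on_imp_deriv_nonneg[OF _ der]) (use x in \<open>simp add: interior_open\<close>)
  have sm: "summable (\<lambda>k. c k * y ^ k)" for y
    using summable_mittag_leffler[of a 2 y] a by (simp add: c_def)
  have "summable (\<lambda>k. diffs c k * (- x) ^ k)"
    by (rule termdiff_converges_all) (rule sm)
  then have "(\<lambda>k. diffs c k * (- x) ^ k) sums D"
    unfolding D_def by (rule summable_sums)
  then have "(\<lambda>k. diffs c k * (- x) ^ k * (- x)) sums (D * (- x))"
    by (rule sums_mult2)
  then have "(\<lambda>k. (\<lambda>k. real k * c k * (- x) ^ k) (Suc k)) sums (D * (- x))"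
    by (simp add: diffs_def mult_ac)
  then have "(\<lambda>k. real k * c k * (- x) ^ k) sums (D * (- x))"
    by (subst (asm) sums_Suc_iff) simp
  then have "(\<lambda>k. a * (real k * c k * (- x) ^ k) + c k * (- x) ^ k) sums
     (a * (D * (- x)) + mittag_leffler a 2 (- x))"
    by (intro sums_add sums_mult) (use summable_sums[OF sm] in \<open>auto simp: mittag_leffler_def c_def\<close>)
  moreover have "a * (real k * c k * (- x) ^ k) + c k * (- x) ^ k = (- x) ^ k / Gamma (real k * a + 1)" for k
  proof -
    have pos: "real k * a + 1 > 0" using a by (simp add: add_nonneg_pos)
    then have "Gamma (real k * a + 2) = (real k * a + 1) * Gamma (real k * a + 1)"
      using Gamma_plus1[of "real k * a + 1"] by (simp add: add.assoc) (metis less_irrefl nonpos_Ints_nonpos not_le)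
    then have "(real k * a + 1) * c k = 1 / Gamma (real k * a + 1)"
      using pos by (simp add: c_def)
    then have "(real k * a + 1) * c k * (- x) ^ k = (- x) ^ k / Gamma (real k * a + 1)"
      by simp
    then show ?thesis by (simp add: algebra_simps)
  qed
  ultimately have "a * (D * (- x)) + mittag_leffler a 2 (- x) = mittag_leffler a 1 (- x)"
    unfolding mittag_leffler_def[of a 1] by (simp add: sums_iff)
  moreover have "a * (D * (- x)) \<le> 0" using a D x by (simp add: mult_nonneg_nonneg)
  ultimately show ?thesis by linarith
qed

text \<open>The shift relation is applied with \<open>b = 2 - a\<close>; since \<open>a < 1\<close>,
  this \<open>b\<close> is at least \<open>a\<close>, so the value that appears there is nonnegative
  and may be dropped.\<close>

lemma mittag_leffler_one_le_inverse:
  assumes a: "0 < a" "a < 1" and x: "0 < x"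
  shows "mittag_leffler a 1 (- x) \<le> 1 / (Gamma (2 - a) * x)"
proof -
  have "- x * mittag_leffler a 2 (- x) = mittag_leffler a (2 - a) (- x) - 1 / Gamma (2 - a)"
    using mittag_leffler_shift[of a "2 - a" "- x"] a by simp
  moreover have "0 \<le> mittag_leffler a (2 - a) (- x)"
    using a x by (intro mittag_leffler_nonneg) auto
  ultimately have "mittag_leffler a 2 (- x) * x \<le> 1 / Gamma (2 - a)" by (simp add: mult.commute)
  then have "mittag_leffler a 2 (- x) \<le> 1 / Gamma (2 - a) / x"
    using x by (subst pos_le_divide_eq) auto
  then show ?thesis
    using mittag_leffler_one_le_two[OF a x] by simp
qed

lemma mittag_leffler_one_bounds:
  assumes "0 < a" "a < 1" "0 \<le> x"
  shows "0 \<le> mittag_leffler a 1 (- x)" "mittag_leffler a 1 (- x) \<le> 1"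
  using mittag_leffler_nonneg[of a 1 x] mittag_leffler_antimono[of a 1 0 x] mittag_leffler_zero[of a 1] assms
  by auto

text \<open>The derivative at 0 is positive, which gives strictness just left of 0; monotonicity
  carries it to every \<open>x\<close>. It makes the constant \<open>\<delta>\<close> of the final
  estimate positive.\<close>

lemma mittag_leffler_one_less_one:
  assumes a: "0 < a" "a < 1" and x: "0 < x"
  shows "mittag_leffler a 1 (- x) < 1"
proof -
  have "mittag_leffler a a 0 / a > 0"
    using a by (simp add: mittag_leffler_zero Gamma_real_pos)
  from DERIV_pos_inc_left[OF mittag_leffler_one_has_derivative[OF a(1)] this]
  obtain d where d: "d > 0" "\<And>h. 0 < h \<Longrightarrow> h < d \<Longrightarrow> mittag_leffler a 1 (- h) < mittag_leffler a 1 0"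
    by auto
  define h where "h = min (d / 2) x"
  have h: "0 < h" "h < d" "h \<le> x" using d(1) x by (auto simp: h_def)
  have "mittag_leffler a 1 (- x) \<le> mittag_leffler a 1 (- h)"
    using a h by (intro mittag_leffler_antimono) auto
  also have "\<dots> < 1" using d(2)[OF h(1,2)] by (simp add: mittag_leffler_zero)
  finally show ?thesis .
qed

text \<open>Mean value theorem on \<open>{- x .. - (x / 2)}\<close>: the derivative there is at
  least \<open>mittag_leffler a a (- x) / a\<close>, and the subtracted value at \<open>- x\<close>
  is nonnegative.\<close>

lemma mittag_leffler_same_le_difference:
  assumes a: "0 < a" "a < 1" and x: "0 < x"
  shows "x * mittag_leffler a a (- x) \<le> 2 * a * mittag_leffler a 1 (- (x / 2))"
proof -
  obtain z where z: "- x < z" "z < - (x / 2)"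
    "mittag_leffler a 1 (- (x / 2)) - mittag_leffler a 1 (- x) = (- (x / 2) - - x) * (mittag_leffler a a z / a)"
    using MVT2[of "- x" "- (x / 2)" "mittag_leffler a 1" "\<lambda>z. mittag_leffler a a z / a"]
      mittag_leffler_one_has_derivative[OF a(1)] x by auto
  have "x * mittag_leffler a a (- x) \<le> x * mittag_leffler a a z"
    using mittag_leffler_antimono[of a a "- z" x] a z x by (intro mult_left_mono) auto
  also have "\<dots> = 2 * a * (mittag_leffler a 1 (- (x / 2)) - mittag_leffler a 1 (- x))"
    using a unfolding z(3) by simp
  also have "\<dots> \<le> 2 * a * mittag_leffler a 1 (- (x / 2))"
    using a x mittag_leffler_one_bounds[of a x] by (intro mult_left_mono) auto
  finally show ?thesis .
qed

lemma mittag_leffler_same_le_inverse: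
  assumes a: "0 < a" "a < 1" and x: "0 \<le> x"
  shows "x * mittag_leffler a a (- x) \<le> 2 * a"
proof (cases "x = 0")
  case False
  then have "mittag_leffler a 1 (- (x / 2)) \<le> 1"
    using a x by (intro mittag_leffler_one_bounds) auto
  then have "2 * a * mittag_leffler a 1 (- (x / 2)) \<le> 2 * a" using a by simp
  then show ?thesis using mittag_leffler_same_le_difference[OF a, of x] False x by linarith
qed (use a in simp)

text \<open>One power of \<open>x\<close> comes from the mean value estimate, the other from the
  decay of \<open>mittag_leffler a 1\<close> at \<open>- (x / 2)\<close>.\<close>

lemma mittag_leffler_same_le_inverse_square:
  assumes a: "0 < a" "a < 1" and x: "0 < x"
  shows "x\<^sup>2 * mittag_leffler a a (- x) \<le> 4 * a / Gamma (2 - a)"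
proof -
  have "x * (x * mittag_leffler a a (- x)) \<le> x * (2 * a * mittag_leffler a 1 (- (x / 2)))"
    using mittag_leffler_same_le_difference[OF a x] x by (intro mult_left_mono) auto
  also have "\<dots> \<le> x * (2 * a * (1 / (Gamma (2 - a) * (x / 2))))"
    using mittag_leffler_one_le_inverse[OF a, of "x / 2"] a x by (intro mult_left_mono) auto
  also have "\<dots> = 4 * a / Gamma (2 - a)" using x by simp
  finally show ?thesis by (simp add: power2_eq_square mult.assoc)
qed

section \<open>The scalar relaxation equation\<close>

text \<open>With \<open>l = lam n\<close> this is the mode function \<open>k\<close>, and
  \<open>ml_relax\<close> is \<open>e\<close>. The convention \<open>0 powr (a - 1) = 0\<close>
  makes the kernel 0 at its singularity.\<close>

definition ml_kernel :: "real \<Rightarrow> real \<Rightarrow> real \<Rightarrow> real" where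
  "ml_kernel a l t = t powr (a - 1) * mittag_leffler a a (- l * t powr a)"

definition ml_relax :: "real \<Rightarrow> real \<Rightarrow> real \<Rightarrow> real" where
  "ml_relax a l t = mittag_leffler a 1 (- l * t powr a)"

lemma ml_kernel_nonneg:
  assumes "0 < a" "a < 1" "0 \<le> l"
  shows "0 \<le> ml_kernel a l t"
  using mittag_leffler_nonneg[of a a "l * t powr a"] assms by (simp add: ml_kernel_def)

text \<open>Comparison with argument 0. The bound is free of \<open>l\<close> and integrable at 0,
  hence a majorant for all modes at once.\<close>

lemma ml_kernel_le:
  assumes "0 < a" "a < 1" "0 \<le> l"
  shows "ml_kernel a l t \<le> t powr (a - 1) / Gamma a"
  using mittag_leffler_antimono[of a a 0 "l * t powr a"] assms
  by (simp add: ml_kernel_def mittag_leffler_zero mult_left_mono divide_inverse)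

lemma ml_relax_bounds:
  assumes "0 < a" "a < 1" "0 \<le> l"
  shows "0 \<le> ml_relax a l t" "ml_relax a l t \<le> 1"
  using mittag_leffler_one_bounds[of a "l * t powr a"] assms by (auto simp: ml_relax_def)

lemma ml_relax_0 [simp]: "0 < a \<Longrightarrow> ml_relax a l 0 = 1"
  by (simp add: ml_relax_def mittag_leffler_zero)

lemma ml_relax_has_derivative:
  assumes "0 < a" "0 < t"
  shows "(ml_relax a l has_real_derivative (- l * ml_kernel a l t)) (at t)"
proof -
  have "((\<lambda>t. mittag_leffler a 1 (- l * t powr a)) has_real_derivative
      mittag_leffler a a (- l * t powr a) / a * (- l * (a * t powr (a - 1)))) (at t)"
    using assms
    by (intro DERIV_chain2[OF mittag_leffler_one_has_derivative] DERIV_cmult has_real_derivative_powr) auto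
  then show ?thesis
    using assms(1) by (simp add: ml_relax_def[abs_def] ml_kernel_def mult_ac)
qed

lemma continuous_on_ml_relax:
  assumes "0 < a"
  shows "continuous_on {0..} (ml_relax a l)"
  unfolding ml_relax_def[abs_def] using assms
  by (intro continuous_on_compose2[OF continuous_on_mittag_leffler_one[OF assms, of UNIV]]
       continuous_intros continuous_on_powr') auto

text \<open>The antiderivative is continuous up to 0, where the kernel is singular, so
  differentiability in the interior is enough.\<close>

lemma ml_kernel_has_integral:
  assumes "0 < a" "0 \<le> s" "s \<le> t" "l \<noteq> 0"
  shows "(ml_kernel a l has_integral ((ml_relax a l s - ml_relax a l t) / l)) {s..t}"
proof -
  have "(ml_kernel a l has_integral (- ml_relax a l t / l - (- ml_relax a l s / l))) {s..t}"
  proof (rule fundamental_theorem_of_calculus_interior[OF assms(3)])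
    show "continuous_on {s..t} (\<lambda>t. - ml_relax a l t / l)"
      using assms by (intro continuous_intros continuous_on_subset[OF continuous_on_ml_relax]) auto
    fix x assume x: "x \<in> {s<..<t}"
    have "((\<lambda>t. - ml_relax a l t / l) has_real_derivative (- (- l * ml_kernel a l x) / l)) (at x)"
      using x assms by (intro DERIV_cdivide DERIV_minus ml_relax_has_derivative) auto
    then show "((\<lambda>t. - ml_relax a l t / l) has_vector_derivative ml_kernel a l x) (at x)"
      using assms(4) by (simp add: has_real_derivative_iff_has_vector_derivative)
  qed
  moreover have "- ml_relax a l t / l - (- ml_relax a l s / l) = (ml_relax a l s - ml_relax a l t) / l"
    by (simp add: diff_divide_distrib)
  ultimately show ?thesis by simp
qed

text \<open>Being nonnegative and integrable, the kernel is absolutely integrable, and a bounded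
  measurable factor preserves this.\<close>

lemma ml_kernel_mult_integrable:
  assumes "0 < a" "a < 1" "0 \<le> s" "0 < l" "continuous_on {s..t} h"
  shows "(\<lambda>x. ml_kernel a l x * h x) integrable_on {s..t}"
proof (cases "s \<le> t")
  case True
  have "ml_kernel a l absolutely_integrable_on {s..t}"
    using ml_kernel_has_integral[of a s t l] True assms ml_kernel_nonneg[of a l]
    by (intro nonnegative_absolutely_integrable_1) auto
  then have "(\<lambda>x. h x * ml_kernel a l x) absolutely_integrable_on {s..t}"
    using assms(5)
    by (intro absolutely_integrable_bounded_measurable_product_real)
       (auto intro: continuous_imp_measurable_on_sets_lebesgue compact_imp_bounded compact_continuous_image)
  then show ?thesis by (simp add: mult.commute set_lebesgue_integral_eq_integral(1))
qed (simp add: integrable_on_empty)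

lemma ml_relax_decrement:
  assumes a: "0 < a" "a < 1" and l: "0 < l" and T: "0 < T" "T < T'"
  obtains x where "T < x" "ml_relax a l T - ml_relax a l T' = (T' - T) * (l * ml_kernel a l x)"
proof -
  obtain z where "T < z" "ml_relax a l T' - ml_relax a l T = (T' - T) * (- l * ml_kernel a l z)"
    using MVT2[of T T' "ml_relax a l" "\<lambda>t. - l * ml_kernel a l t"] ml_relax_has_derivative[OF a(1)] T
    by force
  then show ?thesis by (intro that[of z]) (auto simp: algebra_simps)
qed

text \<open>At the mean value point \<open>x\<close>, put \<open>y = l * x powr a\<close>. Then
  \<open>l * k\<close> is \<open>y * mittag_leffler a a (- y) / x\<close>, and
  \<open>l * l * k\<close> is
  \<open>y\<^sup>2 * mittag_leffler a a (- y) * x powr (- 1 - a)\<close>, so the decay in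
  \<open>y\<close> removes \<open>l\<close>. The second bound serves the source, the third the
  initial value.\<close>

lemma ml_relax_decrement_bounds:
  assumes a: "0 < a" "a < 1" and l: "0 < l" and T: "0 < T" "T < T'"
  shows "0 \<le> ml_relax a l T - ml_relax a l T'"
    and "ml_relax a l T - ml_relax a l T' \<le> (T' - T) * (2 / T)"
    and "l * (ml_relax a l T - ml_relax a l T') \<le> (T' - T) * (4 / Gamma (2 - a) * T powr (- 1 - a))"
proof -
  obtain x where x: "T < x" "ml_relax a l T - ml_relax a l T' = (T' - T) * (l * ml_kernel a l x)"
    using ml_relax_decrement[OF assms] .
  define y where "y = l * x powr a"
  have y: "y > 0" using x l T by (simp add: y_def)
  have x0: "x > 0" using x T by simp
  show "0 \<le> ml_relax a l T - ml_relax a l T'"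
    using ml_kernel_nonneg[OF a, of l x] l T unfolding x(2) by simp
  have "l * ml_kernel a l x = y * mittag_leffler a a (- y) / x"
    using x0 by (simp add: ml_kernel_def y_def powr_diff)
  also have "\<dots> \<le> 2 / x"
    using mittag_leffler_same_le_inverse[OF a, of y] y a x0 by (intro divide_right_mono) auto
  also have "\<dots> \<le> 2 / T"
    using x T by (intro divide_left_mono) auto
  finally show "ml_relax a l T - ml_relax a l T' \<le> (T' - T) * (2 / T)"
    unfolding x(2) using T by (intro mult_left_mono) auto
  have G: "Gamma (2 - a) > 0" using a by (intro Gamma_real_pos) auto
  have "l * (l * ml_kernel a l x) = y\<^sup>2 * mittag_leffler a a (- y) * x powr (- 1 - a)"
    using x0 by (simp add: ml_kernel_def y_def powr_diff powr_minus power2_eq_square field_simps)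
  also have "\<dots> \<le> 4 * a / Gamma (2 - a) * x powr (- 1 - a)"
    using mittag_leffler_same_le_inverse_square[OF a y] by (intro mult_right_mono) auto
  also have "\<dots> \<le> 4 / Gamma (2 - a) * T powr (- 1 - a)"
    using a x T G by (intro mult_mono divide_right_mono powr_mono2') auto
  finally have "(T' - T) * (l * (l * ml_kernel a l x)) \<le> (T' - T) * (4 / Gamma (2 - a) * T powr (- 1 - a))"
    using T by (intro mult_left_mono) auto
  then show "l * (ml_relax a l T - ml_relax a l T') \<le> (T' - T) * (4 / Gamma (2 - a) * T powr (- 1 - a))"
    unfolding x(2) by (simp add: mult_ac)
qed

text \<open>The singular factor carries the variable \<open>s\<close> itself, so a change of
  \<open>t\<close> affects only the smooth factor \<open>g\<close> and the upper limit.\<close>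

definition ml_duhamel :: "real \<Rightarrow> real \<Rightarrow> (real \<Rightarrow> real) \<Rightarrow> real \<Rightarrow> real" where
  "ml_duhamel a l g t = integral {0..t} (\<lambda>s. ml_kernel a l s * g (t - s))"

lemma has_integral_reflect_interval:
  fixes f :: "real \<Rightarrow> 'b::real_normed_vector"
  assumes "(f has_integral I) {0..t}"
  shows "((\<lambda>s. f (t - s)) has_integral I) {0..t}"
  using has_integral_affinity[of f I 0 t "- 1" t] assms by (simp add: image_image)

lemma continuous_on_reflect:
  fixes g :: "real \<Rightarrow> 'b::topological_space"
  assumes "continuous_on {0..T} g" "\<And>x. x \<in> S \<Longrightarrow> t - x \<in> {0..T}"
  shows "continuous_on S (\<lambda>x. g (t - x))"
  using assms by (intro continuous_on_compose2[OF assms(1)] continuous_intros) auto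

lemma ml_duhamel_has_integral:
  assumes "0 < a" "a < 1" "0 < l" "continuous_on {0..t} g"
  shows "((\<lambda>s. ml_kernel a l (t - s) * g s) has_integral ml_duhamel a l g t) {0..t}"
proof -
  have "(\<lambda>s. ml_kernel a l s * g (t - s)) integrable_on {0..t}"
    using assms by (intro ml_kernel_mult_integrable continuous_on_reflect[OF assms(4)]) auto
  then have "((\<lambda>s. ml_kernel a l s * g (t - s)) has_integral ml_duhamel a l g t) {0..t}"
    unfolding ml_duhamel_def by (rule integrable_integral)
  from has_integral_reflect_interval[OF this] show ?thesis by simp
qed

text \<open>The kernel is nonnegative with total mass \<open>(1 - ml_relax a l t) / l\<close>, so
  \<open>g\<close> may be replaced by its lower bound.\<close>

lemma ml_duhamel_lower_bound:
  assumes a: "0 < a" "a < 1" and l: "0 < l" and t: "0 \<le> t"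
    and g: "continuous_on {0..t} g" "\<And>s. s \<in> {0..t} \<Longrightarrow> cg \<le> g s"
  shows "cg * (1 - ml_relax a l t) \<le> l * ml_duhamel a l g t"
proof -
  have "((\<lambda>s. ml_kernel a l s * cg) has_integral ((ml_relax a l 0 - ml_relax a l t) / l * cg)) {0..t}"
    using a l t by (intro has_integral_mult_left ml_kernel_has_integral) auto
  moreover have "(\<lambda>s. ml_kernel a l s * g (t - s)) integrable_on {0..t}"
    using a l g by (intro ml_kernel_mult_integrable continuous_on_reflect[OF g(1)]) auto
  then have "((\<lambda>s. ml_kernel a l s * g (t - s)) has_integral ml_duhamel a l g t) {0..t}"
    unfolding ml_duhamel_def by (rule integrable_integral)
  ultimately have "(ml_relax a l 0 - ml_relax a l t) / l * cg \<le> ml_duhamel a l g t"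
    by (rule has_integral_le) (use a l g ml_kernel_nonneg in \<open>auto intro!: mult_left_mono\<close>)
  then show ?thesis using l a by (simp add: field_simps)
qed

text \<open>The integral up to \<open>T'\<close> is split at \<open>T\<close>. The piece beyond
  \<open>T\<close> is at most \<open>M\<close> times the mass of the kernel there, a decrement of
  \<open>ml_relax\<close>; on \<open>{0..T}\<close> the Lipschitz bound for \<open>g\<close> meets a
  mass of at most \<open>1 / l\<close>.\<close>

lemma ml_duhamel_increment:
  assumes a: "0 < a" "a < 1" and l: "0 < l" and T: "0 < T" "T < T'"
    and g: "continuous_on {0..T'} g" "\<And>s. s \<in> {0..T'} \<Longrightarrow> \<bar>g s\<bar> \<le> M"
    and lip: "\<And>s r. s \<in> {0..T'} \<Longrightarrow> r \<in> {0..T'} \<Longrightarrow> \<bar>g s - g r\<bar> \<le> M * \<bar>s - r\<bar>"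
  shows "\<bar>l * (ml_duhamel a l g T' - ml_duhamel a l g T)\<bar> \<le> (T' - T) * (M * (1 + 2 / T))"
proof -
  let ?k = "ml_kernel a l"
  have k0: "0 \<le> ?k x" for x using ml_kernel_nonneg[of a l] a l by simp
  have M: "0 \<le> M" using g(2)[of 0] T by (smt (verit) atLeastAtMost_iff)
  have i: "(\<lambda>s. ?k s * g (T' - s)) integrable_on {0..T'}" "(\<lambda>s. ?k s * g (T' - s)) integrable_on {0..T}"
     "(\<lambda>s. ?k s * g (T' - s)) integrable_on {T..T'}" "(\<lambda>s. ?k s * g (T - s)) integrable_on {0..T}"
    using a l T by (auto intro!: ml_kernel_mult_integrable continuous_on_reflect[OF g(1)])
  have "ml_duhamel a l g T' = integral {0..T} (\<lambda>s. ?k s * g (T' - s)) + integral {T..T'} (\<lambda>s. ?k s * g (T' - s))"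
    unfolding ml_duhamel_def using T by (intro Henstock_Kurzweil_Integration.integral_combine[symmetric] i) auto
  then have eq: "ml_duhamel a l g T' - ml_duhamel a l g T =
      integral {T..T'} (\<lambda>s. ?k s * g (T' - s)) + integral {0..T} (\<lambda>s. ?k s * g (T' - s) - ?k s * g (T - s))"
    unfolding ml_duhamel_def[of _ _ _ T] using i by (simp add: Henstock_Kurzweil_Integration.integral_diff)
  have 1: "\<bar>integral {T..T'} (\<lambda>s. ?k s * g (T' - s))\<bar> \<le> (ml_relax a l T - ml_relax a l T') / l * M"
  proof -
    have k: "((\<lambda>s. ?k s * M) has_integral ((ml_relax a l T - ml_relax a l T') / l * M)) {T..T'}"
      using a l T by (intro has_integral_mult_left ml_kernel_has_integral) auto
    have "norm (integral {T..T'} (\<lambda>s. ?k s * g (T' - s))) \<le> integral {T..T'} (\<lambda>s. ?k s * M)"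
      using i k k0 g(2) T
      by (intro integral_norm_bound_integral) (auto simp: abs_mult intro!: mult_left_mono)
    then show ?thesis by (simp only: integral_unique[OF k] real_norm_def)
  qed
  have 2: "\<bar>integral {0..T} (\<lambda>s. ?k s * g (T' - s) - ?k s * g (T - s))\<bar> \<le> (ml_relax a l 0 - ml_relax a l T) / l * (M * (T' - T))"
  proof -
    have k: "((\<lambda>s. ?k s * (M * (T' - T))) has_integral ((ml_relax a l 0 - ml_relax a l T) / l * (M * (T' - T)))) {0..T}"
      using a l T by (intro has_integral_mult_left ml_kernel_has_integral) auto
    have "norm (?k s * g (T' - s) - ?k s * g (T - s)) \<le> ?k s * (M * (T' - T))" if "s \<in> {0..T}" for s
    proof -
      have "norm (?k s * g (T' - s) - ?k s * g (T - s)) = ?k s * \<bar>g (T' - s) - g (T - s)\<bar>"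
        using k0 by (simp add: abs_mult flip: right_diff_distrib)
      also have "\<dots> \<le> ?k s * (M * (T' - T))"
        using lip[of "T' - s" "T - s"] that T k0 by (intro mult_left_mono) auto
      finally show ?thesis .
    qed
    then have "norm (integral {0..T} (\<lambda>s. ?k s * g (T' - s) - ?k s * g (T - s))) \<le> integral {0..T} (\<lambda>s. ?k s * (M * (T' - T)))"
      using i k by (intro integral_norm_bound_integral Henstock_Kurzweil_Integration.integrable_diff) auto
    then show ?thesis by (simp only: integral_unique[OF k] real_norm_def)
  qed
  have "\<bar>l * (ml_duhamel a l g T' - ml_duhamel a l g T)\<bar> = l * \<bar>ml_duhamel a l g T' - ml_duhamel a l g T\<bar>"
    using l by (simp add: abs_mult)
  also have "\<dots> \<le> l * ((ml_relax a l T - ml_relax a l T') / l * M + (ml_relax a l 0 - ml_relax a l T) / l * (M * (T' - T)))"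
    unfolding eq using 1 2 l by (intro mult_left_mono) linarith+
  also have "\<dots> = (ml_relax a l T - ml_relax a l T') * M + (ml_relax a l 0 - ml_relax a l T) * (M * (T' - T))"
    using l by (simp add: distrib_left)
  also have "\<dots> \<le> (T' - T) * (2 / T) * M + 1 * (M * (T' - T))"
    using ml_relax_decrement_bounds[OF a l T] ml_relax_bounds[OF a, of l T] a l T M
    by (intro add_mono mult_right_mono) auto
  also have "\<dots> = (T' - T) * (M * (1 + 2 / T))" by (simp add: algebra_simps)
  finally show ?thesis .
qed

lemma ml_duhamel_abs_le:
  assumes a: "0 < a" "a < 1" and l: "0 < l" and t: "0 \<le> t"
    and g: "continuous_on {0..t} g" "\<And>s. s \<in> {0..t} \<Longrightarrow> \<bar>g s\<bar> \<le> M"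
  shows "\<bar>ml_duhamel a l g t\<bar> \<le> M / l"
proof -
  have M: "0 \<le> M" using g(2)[of 0] t by (smt (verit) atLeastAtMost_iff)
  have k: "((\<lambda>s. ml_kernel a l s * M) has_integral ((ml_relax a l 0 - ml_relax a l t) / l * M)) {0..t}"
    using a l t by (intro has_integral_mult_left ml_kernel_has_integral) auto
  have "norm (ml_duhamel a l g t) \<le> integral {0..t} (\<lambda>s. ml_kernel a l s * M)"
    unfolding ml_duhamel_def using a l g k ml_kernel_nonneg[OF a, of l]
    by (intro integral_norm_bound_integral ml_kernel_mult_integrable continuous_on_reflect[OF g(1)])
       (auto simp: abs_mult intro!: mult_left_mono)
  also have "\<dots> \<le> 1 / l * M"
    unfolding integral_unique[OF k] using ml_relax_bounds[OF a, of l t] a l M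
    by (intro mult_right_mono divide_right_mono) auto
  finally show ?thesis by simp
qed

section \<open>Orthonormal expansions\<close>

text \<open>The majorants make this usable for infinite-dimensional targets, with no measurability.\<close>

lemma has_integral_dominated_approximation:
  fixes f :: "real \<Rightarrow> 'b::real_normed_vector"
  assumes F: "\<And>N. (F N has_integral L N) {a..b}" and L: "L \<longlonglongrightarrow> I"
    and h: "\<And>N. (h N has_integral H N) {a..b}" and H: "H \<longlonglongrightarrow> 0"
    and le: "\<And>N x. x \<in> {a..b} \<Longrightarrow> norm (f x - F N x) \<le> h N x"
  shows "(f has_integral I) {a..b}"
  unfolding has_integral_real
proof (intro allI impI)
  fix e :: real assume e: "e > 0"
  \<comment> \<open>Error budget: \<open>e / 4\<close> each for the Riemann sum of
    \<open>F N\<close> and for the limit of \<open>L\<close>, and \<open>e / 2\<close> for the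
    Riemann sum of the majorant, which controls that of \<open>f - F N\<close> because tags lie in
    the interval.\<close>
  have "eventually (\<lambda>N. dist (L N) I < e / 4 \<and> H N < e / 4) sequentially"
    using L H e by (intro eventually_conj tendstoD order_tendstoD) auto
  then obtain N where N: "norm (L N - I) < e / 4" "H N < e / 4"
    using eventually_happens' sequentially_bot by (force simp: dist_norm)
  obtain \<gamma>1 where \<gamma>1: "gauge \<gamma>1" "\<And>\<D>. \<D> tagged_division_of {a..b} \<Longrightarrow> \<gamma>1 fine \<D> \<Longrightarrow>
      norm ((\<Sum>(x,k)\<in>\<D>. measure lborel k *\<^sub>R F N x) - L N) < e / 4"
    using F[of N] e unfolding has_integral_real by (meson divide_pos_pos zero_less_numeral)
  obtain \<gamma>2 where \<gamma>2: "gauge \<gamma>2" "\<And>\<D>. \<D> tagged_division_of {a..b} \<Longrightarrow> \<gamma>2 fine \<D> \<Longrightarrow>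
      norm ((\<Sum>(x,k)\<in>\<D>. measure lborel k *\<^sub>R h N x) - H N) < e / 4"
    using h[of N] e unfolding has_integral_real by (meson divide_pos_pos zero_less_numeral)
  show "\<exists>\<gamma>. gauge \<gamma> \<and> (\<forall>\<D>. \<D> tagged_division_of {a..b} \<and> \<gamma> fine \<D> \<longrightarrow>
      norm ((\<Sum>(x,k)\<in>\<D>. measure lborel k *\<^sub>R f x) - I) < e)"
  proof (intro exI[of _ "\<lambda>x. \<gamma>1 x \<inter> \<gamma>2 x"] conjI allI impI gauge_Int \<gamma>1 \<gamma>2)
    fix \<D> assume \<D>: "\<D> tagged_division_of {a..b} \<and> (\<lambda>x. \<gamma>1 x \<inter> \<gamma>2 x) fine \<D>"
    then have d: "\<D> tagged_division_of {a..b}" "\<gamma>1 fine \<D>" "\<gamma>2 fine \<D>" by (auto simp: fine_Int)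
    let ?S = "\<lambda>f. \<Sum>(x,k)\<in>\<D>. measure lborel k *\<^sub>R f x"
    have "norm (?S f - ?S (F N)) = norm (\<Sum>(x,k)\<in>\<D>. measure lborel k *\<^sub>R (f x - F N x))"
      by (simp add: sum_subtractf[symmetric] scaleR_diff_right split_def)
    also have "\<dots> \<le> ?S (h N)"
      by (rule sum_norm_le) (use d(1) in \<open>auto intro!: mult_left_mono le dest: tag_in_interval\<close>)
    finally have "norm (?S f - ?S (F N)) \<le> ?S (h N)" .
    moreover have "norm (?S f - I) \<le> norm (?S f - ?S (F N)) + norm (?S (F N) - L N) + norm (L N - I)"
      by norm
    moreover have "?S (h N) < e / 2" using \<gamma>2(2)[OF d(1,3)] N(2) unfolding real_norm_def by linarith
    ultimately show "norm (?S f - I) < e" using \<gamma>1(2)[OF d(1,2)] N(1) by simp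
  qed
qed

section \<open>Convergence, tails and norms of orthonormal series\<close>

lemma norm_sum_orthonormal:
  fixes phi :: "nat \<Rightarrow> 'h::real_inner"
  assumes on: "\<And>m n. inner (phi m) (phi n) = (if m = n then 1 else 0)" and "finite A"
  shows "(norm (\<Sum>n\<in>A. c n *\<^sub>R phi n))\<^sup>2 = (\<Sum>n\<in>A. (c n)\<^sup>2)"
proof -
  have "inner (\<Sum>n\<in>A. c n *\<^sub>R phi n) (\<Sum>n\<in>A. c n *\<^sub>R phi n) = (\<Sum>n\<in>A. c n * c n)"
    using assms(2) by (simp add: inner_sum_left inner_sum_right on if_distrib cong: if_cong)
  then show ?thesis unfolding power2_norm_eq_inner by (simp add: power2_eq_square)
qed

lemma summable_orthonormal:
  fixes phi :: "nat \<Rightarrow> 'h::{real_inner,complete_space}"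
  assumes on: "\<And>m n. inner (phi m) (phi n) = (if m = n then 1 else 0)"
    and c: "summable (\<lambda>n. (c n)\<^sup>2)"
  shows "summable (\<lambda>n. c n *\<^sub>R phi n)"
proof -
  have "Cauchy (\<lambda>n. \<Sum>i<n. c i *\<^sub>R phi i)"
  proof (rule metric_CauchyI)
    fix e :: real assume e: "e > 0"
    then obtain N where N: "\<And>m n. m \<ge> N \<Longrightarrow> norm (\<Sum>i=m..<n. (c i)\<^sup>2) < e\<^sup>2"
      using c unfolding summable_Cauchy by (meson zero_less_power)
    have *: "dist (\<Sum>i<m. c i *\<^sub>R phi i) (\<Sum>i<n. c i *\<^sub>R phi i) < e" if "N \<le> m" "m \<le> n" for m n
    proof -
      have "(\<Sum>i<n. c i *\<^sub>R phi i) - (\<Sum>i<m. c i *\<^sub>R phi i) = (\<Sum>i=m..<n. c i *\<^sub>R phi i)"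
        using sum_diff_nat_ivl[of 0 m n "\<lambda>i. c i *\<^sub>R phi i"] that by (simp add: atLeast0LessThan)
      then have "(dist (\<Sum>i<m. c i *\<^sub>R phi i) (\<Sum>i<n. c i *\<^sub>R phi i))\<^sup>2 = (\<Sum>i=m..<n. (c i)\<^sup>2)"
        by (simp add: dist_norm norm_minus_commute[of "sum _ {..<m}"] norm_sum_orthonormal[OF on])
      also have "\<dots> < e\<^sup>2" using N[OF that(1), of n] by simp
      finally show ?thesis using e by (simp add: power2_less_imp_less)
    qed
    show "\<exists>M. \<forall>m\<ge>M. \<forall>n\<ge>M. dist (\<Sum>i<m. c i *\<^sub>R phi i) (\<Sum>i<n. c i *\<^sub>R phi i) < e"
      using * by (metis dist_commute nle_le)
  qed
  then show ?thesis
    using Cauchy_convergent summable_iff_convergent by blast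
qed

lemma inner_suminf_orthonormal:
  fixes phi :: "nat \<Rightarrow> 'h::{real_inner,complete_space}"
  assumes on: "\<And>m n. inner (phi m) (phi n) = (if m = n then 1 else 0)"
    and c: "summable (\<lambda>n. (c n)\<^sup>2)"
  shows "inner (\<Sum>n. c n *\<^sub>R phi n) (phi m) = c m"
proof -
  have "(\<lambda>n. inner (c n *\<^sub>R phi n) (phi m)) sums inner (\<Sum>n. c n *\<^sub>R phi n) (phi m)"
    by (intro bounded_linear.sums[OF bounded_linear_inner_left] summable_sums summable_orthonormal assms)
  moreover have "inner (c n *\<^sub>R phi n) (phi m) = (if n = m then c n else 0)" for n
    by (simp add: on)
  ultimately have "(\<lambda>n. if n = m then c n else 0) sums inner (\<Sum>n. c n *\<^sub>R phi n) (phi m)"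
    by simp
  then show ?thesis using sums_single[of m c] sums_unique2 by blast
qed

lemma norm_suminf_orthonormal:
  fixes phi :: "nat \<Rightarrow> 'h::{real_inner,complete_space}"
  assumes on: "\<And>m n. inner (phi m) (phi n) = (if m = n then 1 else 0)"
    and c: "summable (\<lambda>n. (c n)\<^sup>2)"
  shows "(norm (\<Sum>n. c n *\<^sub>R phi n))\<^sup>2 = (\<Sum>n. (c n)\<^sup>2)"
proof -
  have "(\<lambda>n. (norm (\<Sum>i<n. c i *\<^sub>R phi i))\<^sup>2) \<longlonglongrightarrow> (norm (\<Sum>n. c n *\<^sub>R phi n))\<^sup>2"
    by (intro tendsto_intros summable_LIMSEQ summable_orthonormal assms)
  moreover have "(\<lambda>n. (norm (\<Sum>i<n. c i *\<^sub>R phi i))\<^sup>2) \<longlonglongrightarrow> (\<Sum>n. (c n)\<^sup>2)"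
    using summable_LIMSEQ[OF c] by (simp add: norm_sum_orthonormal[OF on])
  ultimately show ?thesis by (rule LIMSEQ_unique)
qed

lemma summable_square_dominated:
  fixes c d :: "nat \<Rightarrow> real"
  assumes "summable (\<lambda>n. (d n)\<^sup>2)" "\<And>n. \<bar>c n\<bar> \<le> B * \<bar>d n\<bar>"
  shows "summable (\<lambda>n. (c n)\<^sup>2)"
proof (rule summable_comparison_test'[where N = 0])
  show "summable (\<lambda>n. B\<^sup>2 * (d n)\<^sup>2)" using assms(1) by (rule summable_mult)
  show "norm ((c n)\<^sup>2) \<le> B\<^sup>2 * (d n)\<^sup>2" for n
    using power_mono[OF assms(2)[of n], of 2] by (simp add: power_mult_distrib)
qed

text \<open>Separates the two dependences of the tail: the coefficients \<open>c\<close> and the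
  factor \<open>B\<close> may vary with time, while the tail of \<open>d\<close> depends on
  \<open>N\<close> alone.\<close>

lemma norm_orthonormal_tail_le:
  fixes phi :: "nat \<Rightarrow> 'h::{real_inner,complete_space}"
  assumes on: "\<And>m n. inner (phi m) (phi n) = (if m = n then 1 else 0)"
    and d: "summable (\<lambda>n. (d n)\<^sup>2)" and cd: "\<And>n. \<bar>c n\<bar> \<le> B * \<bar>d n\<bar>" and B: "0 \<le> B"
  shows "norm ((\<Sum>n. c n *\<^sub>R phi n) - (\<Sum>n<N. c n *\<^sub>R phi n)) \<le> B * sqrt (\<Sum>n. (d (n + N))\<^sup>2)"
proof -
  have c: "summable (\<lambda>n. (c n)\<^sup>2)" by (rule summable_square_dominated[OF d cd])
  have dN: "summable (\<lambda>n. (d (n + N))\<^sup>2)" "summable (\<lambda>n. (c (n + N))\<^sup>2)"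
    using d c by (simp_all add: summable_iff_shift[of "\<lambda>n. (d n)\<^sup>2"] summable_iff_shift[of "\<lambda>n. (c n)\<^sup>2"])
  \<comment> \<open>The shifted system is again orthonormal, so the norm identity applies to the
    tail.\<close>
  have on': "inner (phi (m + N)) (phi (n + N)) = (if m = n then 1 else 0)" for m n
    by (simp add: on)
  have "(\<Sum>n. c n *\<^sub>R phi n) - (\<Sum>n<N. c n *\<^sub>R phi n) = (\<Sum>n. c (n + N) *\<^sub>R phi (n + N))"
    by (simp add: suminf_split_initial_segment[OF summable_orthonormal[OF on c], of N])
  then have "(norm ((\<Sum>n. c n *\<^sub>R phi n) - (\<Sum>n<N. c n *\<^sub>R phi n)))\<^sup>2 = (\<Sum>n. (c (n + N))\<^sup>2)"
    using norm_suminf_orthonormal[of "\<lambda>n. phi (n + N)" "\<lambda>n. c (n + N)", OF on' dN(2)] by simp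
  also have "\<dots> \<le> (\<Sum>n. B\<^sup>2 * (d (n + N))\<^sup>2)"
  proof (intro suminf_le dN summable_mult)
    show "(c (n + N))\<^sup>2 \<le> B\<^sup>2 * (d (n + N))\<^sup>2" for n
      using power_mono[OF cd[of "n + N"], of 2] by (simp add: power_mult_distrib)
  qed
  also have "\<dots> = (B * sqrt (\<Sum>n. (d (n + N))\<^sup>2))\<^sup>2"
    using dN by (simp add: suminf_mult power_mult_distrib suminf_nonneg)
  finally show ?thesis
    by (rule power2_le_imp_le) (use B dN in \<open>auto intro!: mult_nonneg_nonneg suminf_nonneg\<close>)
qed

lemma suminf_tail_tendsto_0:
  fixes f :: "nat \<Rightarrow> real"
  assumes "summable f"
  shows "(\<lambda>N. \<Sum>n. f (n + N)) \<longlonglongrightarrow> 0"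
proof -
  have "(\<lambda>N. suminf f - (\<Sum>n<N. f n)) \<longlonglongrightarrow> suminf f - suminf f"
    by (intro tendsto_intros summable_LIMSEQ assms)
  then show ?thesis by (simp add: suminf_minus_initial_segment[OF assms])
qed

lemma bessel_summable:
  fixes phi :: "nat \<Rightarrow> 'h::real_inner"
  assumes on: "\<And>m n. inner (phi m) (phi n) = (if m = n then 1 else 0)"
  shows "summable (\<lambda>n. (inner v (phi n))\<^sup>2)"
proof (rule summableI_nonneg_bounded)
  fix N
  define s where "s = (\<Sum>n<N. inner v (phi n) *\<^sub>R phi n)"
  have ss: "inner s s = (\<Sum>n<N. (inner v (phi n))\<^sup>2)"
    using norm_sum_orthonormal[OF on, of "{..<N}" "\<lambda>n. inner v (phi n)"]
    by (simp add: s_def power2_norm_eq_inner)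
  have vs: "inner v s = (\<Sum>n<N. (inner v (phi n))\<^sup>2)"
    by (simp add: s_def inner_sum_right power2_eq_square)
  have "0 \<le> inner (v - s) (v - s)" by simp
  also have "\<dots> = inner v v - (\<Sum>n<N. (inner v (phi n))\<^sup>2)"
    using ss vs by (simp add: inner_diff_left inner_diff_right inner_commute)
  finally show "(\<Sum>n<N. (inner v (phi n))\<^sup>2) \<le> inner v v" by simp
qed simp

text \<open>The difference of \<open>v\<close> and its expansion has vanishing coefficients, hence
  is zero by completeness.\<close>

lemma parseval:
  fixes phi :: "nat \<Rightarrow> 'h::{real_inner,complete_space}"
  assumes on: "\<And>m n. inner (phi m) (phi n) = (if m = n then 1 else 0)"
    and complete: "\<And>v. (\<And>n. inner v (phi n) = 0) \<Longrightarrow> v = 0"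
  shows "(norm v)\<^sup>2 = (\<Sum>n. (inner v (phi n))\<^sup>2)"
proof -
  define w where "w = (\<Sum>n. inner v (phi n) *\<^sub>R phi n)"
  have "v - w = 0"
    by (rule complete) (simp add: w_def inner_diff_left inner_suminf_orthonormal[OF on bessel_summable[OF on]])
  moreover have "(norm w)\<^sup>2 = (\<Sum>n. (inner v (phi n))\<^sup>2)"
    unfolding w_def by (rule norm_suminf_orthonormal[OF on bessel_summable[OF on]])
  ultimately show ?thesis by simp
qed

section \<open>The stability estimate\<close>

lemma spectral_dataD:
  assumes "spectral_data phi lam"
  shows "inner (phi m) (phi n) = (if m = n then 1 else 0)"
    and "(\<And>n. inner v (phi n) = 0) \<Longrightarrow> v = 0"
    and "0 < lam 0" "lam 0 \<le> lam n" "0 < lam n"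
proof -
  show l: "lam 0 \<le> lam n" using assms by (simp add: spectral_data_def mono_def)
  show "0 < lam 0" using assms by (simp add: spectral_data_def)
  with l show "0 < lam n" by simp
qed (use assms in \<open>auto simp: spectral_data_def\<close>)

text \<open>Multipliers in \<open>{0..1}\<close> keep the coefficients square summable, so the
  series defining \<open>solF\<close> converges.\<close>

lemma inner_solF:
  assumes sd: "spectral_data phi lam" and a: "0 < a" "a < 1"
  shows "inner (solF phi lam a t v) (phi n) = ml_relax a (lam n) t * inner v (phi n)"
proof -
  note on = spectral_dataD(1)[OF sd]
  have "\<bar>ml_relax a (lam n) t * inner v (phi n)\<bar> \<le> 1 * \<bar>inner v (phi n)\<bar>" for n
    unfolding abs_mult using ml_relax_bounds[OF a, of "lam n" t] spectral_dataD(5)[OF sd, of n]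
    by (intro mult_right_mono) auto
  then have "summable (\<lambda>n. (ml_relax a (lam n) t * inner v (phi n))\<^sup>2)"
    by (rule summable_square_dominated[OF bessel_summable[OF on]])
  from inner_suminf_orthonormal[OF on this] show ?thesis
    by (simp add: solF_def ml_relax_def)
qed

text \<open>Integral and series are interchanged by approximating with partial sums. The error is at
  most the weakly singular \<open>(t - s) powr (a - 1)\<close> times a constant times the tail
  \<open>e N\<close>, and its integral tends to 0.\<close>

lemma solE_duhamel_has_integral:
  fixes phi :: "nat \<Rightarrow> 'h::{real_inner,complete_space}"
  assumes sd: "spectral_data phi lam" and a: "0 < a" "a < 1" and t: "0 \<le> t"
    and g: "continuous_on {0..t} g" "\<And>s. s \<in> {0..t} \<Longrightarrow> \<bar>g s\<bar> \<le> M"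
  shows "((\<lambda>s. solE phi lam a (t - s) (g s *\<^sub>R psi)) has_integral
           (\<Sum>n. (ml_duhamel a (lam n) g t * inner psi (phi n)) *\<^sub>R phi n)) {0..t}"
    and "summable (\<lambda>n. (ml_duhamel a (lam n) g t * inner psi (phi n))\<^sup>2)"
proof -
  note on = spectral_dataD(1)[OF sd] and lam = spectral_dataD(3-5)[OF sd]
  note bs = bessel_summable[OF on, of psi]
  define G where "G n = ml_duhamel a (lam n) g t" for n
  define e where "e N = sqrt (\<Sum>n. (inner psi (phi (n + N)))\<^sup>2)" for N
  have M: "0 \<le> M" using g(2)[of 0] t by (smt (verit) atLeastAtMost_iff)
  have "\<bar>G n * inner psi (phi n)\<bar> \<le> M / lam 0 * \<bar>inner psi (phi n)\<bar>" for n
  proof -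
    have "\<bar>G n\<bar> \<le> M / lam n" unfolding G_def using a lam t g by (intro ml_duhamel_abs_le) auto
    also have "\<dots> \<le> M / lam 0" using lam M by (intro divide_left_mono) auto
    finally show ?thesis unfolding abs_mult by (intro mult_right_mono) auto
  qed
  then have sm: "summable (\<lambda>n. (G n * inner psi (phi n))\<^sup>2)"
    by (rule summable_square_dominated[OF bs])
  then show "summable (\<lambda>n. (ml_duhamel a (lam n) g t * inner psi (phi n))\<^sup>2)"
    by (simp add: G_def)
  have "((\<lambda>s. solE phi lam a (t - s) (g s *\<^sub>R psi)) has_integral
           (\<Sum>n. (G n * inner psi (phi n)) *\<^sub>R phi n)) {0..t}"
  proof (rule has_integral_dominated_approximation)
    show "((\<lambda>s. \<Sum>n<N. (ml_kernel a (lam n) (t - s) * g s * inner psi (phi n)) *\<^sub>R phi n) has_integral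
            (\<Sum>n<N. (G n * inner psi (phi n)) *\<^sub>R phi n)) {0..t}" for N
      unfolding G_def using a lam g
      by (intro has_integral_sum has_integral_scaleR_left has_integral_mult_left ml_duhamel_has_integral) auto
    show "(\<lambda>N. \<Sum>n<N. (G n * inner psi (phi n)) *\<^sub>R phi n) \<longlonglongrightarrow> (\<Sum>n. (G n * inner psi (phi n)) *\<^sub>R phi n)"
      by (intro summable_LIMSEQ summable_orthonormal on sm)
    have "((\<lambda>s. s powr (a - 1)) has_integral (t powr (a - 1 + 1) / (a - 1 + 1))) {0..t}"
      using a t by (intro has_integral_powr_from_0) auto
    from has_integral_reflect_interval[OF this]
    show "((\<lambda>s. (t - s) powr (a - 1) / Gamma a * M * e N) has_integral (t powr a / a / Gamma a * M * e N)) {0..t}" for N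
      by (intro has_integral_mult_left has_integral_divide) simp
    have "e \<longlonglongrightarrow> sqrt 0"
      unfolding e_def using suminf_tail_tendsto_0[OF bs] by (intro tendsto_intros) 
    then have "(\<lambda>N. t powr a / a / Gamma a * M * e N) \<longlonglongrightarrow> t powr a / a / Gamma a * M * 0"
      by (intro tendsto_mult tendsto_const) simp
    then show "(\<lambda>N. t powr a / a / Gamma a * M * e N) \<longlonglongrightarrow> 0" by simp
    fix N s assume s: "s \<in> {0..t}"
    \<comment> \<open>At \<open>s = t\<close> both sides are 0, as
      \<open>0 powr (a - 1) = 0\<close>.\<close>
    have "\<bar>ml_kernel a (lam n) (t - s) * g s * inner psi (phi n)\<bar> \<le> ((t - s) powr (a - 1) / Gamma a * M) * \<bar>inner psi (phi n)\<bar>" for n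
      unfolding abs_mult
      using ml_kernel_nonneg[OF a, of "lam n"] ml_kernel_le[OF a, of "lam n"] lam(3)[of n] g(2)[OF s] Gamma_real_pos[OF a(1)]
      by (intro mult_right_mono mult_mono) (auto simp: less_imp_le)
    from norm_orthonormal_tail_le[OF on bs this, of N]
    have "norm ((\<Sum>n. (ml_kernel a (lam n) (t - s) * g s * inner psi (phi n)) *\<^sub>R phi n)
        - (\<Sum>n<N. (ml_kernel a (lam n) (t - s) * g s * inner psi (phi n)) *\<^sub>R phi n))
        \<le> (t - s) powr (a - 1) / Gamma a * M * e N"
      using M a by (simp add: e_def Gamma_real_pos less_imp_le)
    then show "norm (solE phi lam a (t - s) (g s *\<^sub>R psi)
        - (\<Sum>n<N. (ml_kernel a (lam n) (t - s) * g s * inner psi (phi n)) *\<^sub>R phi n))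
        \<le> (t - s) powr (a - 1) / Gamma a * M * e N"
      by (simp add: solE_def ml_kernel_def mult.assoc)
  qed
  then show "((\<lambda>s. solE phi lam a (t - s) (g s *\<^sub>R psi)) has_integral
           (\<Sum>n. (ml_duhamel a (lam n) g t * inner psi (phi n)) *\<^sub>R phi n)) {0..t}"
    by (simp add: G_def)
qed

lemma inner_solP:
  assumes sd: "spectral_data phi lam" and a: "0 < a" "a < 1" and t: "0 \<le> t"
    and g: "continuous_on {0..t} g" "\<And>s. s \<in> {0..t} \<Longrightarrow> \<bar>g s\<bar> \<le> M"
  shows "inner (solP phi lam a u0 (\<lambda>s. g s *\<^sub>R psi) t) (phi n) =
    ml_relax a (lam n) t * inner u0 (phi n) + ml_duhamel a (lam n) g t * inner psi (phi n)"
proof -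
  have "integral {0..t} (\<lambda>s. solE phi lam a (t - s) (g s *\<^sub>R psi)) =
      (\<Sum>n. (ml_duhamel a (lam n) g t * inner psi (phi n)) *\<^sub>R phi n)"
    by (rule integral_unique[OF solE_duhamel_has_integral(1)[OF sd a t g]])
  moreover have "inner (\<Sum>n. (ml_duhamel a (lam n) g t * inner psi (phi n)) *\<^sub>R phi n) (phi n) =
      ml_duhamel a (lam n) g t * inner psi (phi n)"
    by (rule inner_suminf_orthonormal[OF spectral_dataD(1)[OF sd] solE_duhamel_has_integral(2)[OF sd a t g]])
  ultimately show ?thesis
    by (simp add: solP_def inner_add_left inner_solF[OF sd a])
qed

lemma C2_boundedD:
  assumes "C2_bounded T' M g"
  shows "continuous_on {0..T'} g"
    and "t \<in> {0..T'} \<Longrightarrow> \<bar>g t\<bar> \<le> M"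
    and "s \<in> {0..T'} \<Longrightarrow> r \<in> {0..T'} \<Longrightarrow> \<bar>g s - g r\<bar> \<le> M * \<bar>s - r\<bar>"
proof -
  from assms obtain g1 where g1: "\<And>t. t \<in> {0..T'} \<Longrightarrow> (g has_real_derivative g1 t) (at t within {0..T'})"
    and b: "\<And>t. t \<in> {0..T'} \<Longrightarrow> \<bar>g t\<bar> \<le> M \<and> \<bar>g1 t\<bar> \<le> M"
    unfolding C2_bounded_def by blast
  show "continuous_on {0..T'} g" by (rule DERIV_continuous_on[OF g1])
  show "t \<in> {0..T'} \<Longrightarrow> \<bar>g t\<bar> \<le> M" using b by blast
  show "s \<in> {0..T'} \<Longrightarrow> r \<in> {0..T'} \<Longrightarrow> \<bar>g s - g r\<bar> \<le> M * \<bar>s - r\<bar>"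
    using field_differentiable_bound[of "{0..T'}" g g1 M s r] g1 b by simp
qed

text \<open>The unknown is isolated by
  \<open>G * p - G' * p' = G * (p - p') - (G' - G) * p'\<close>; its factor \<open>l * G\<close> is
  at least \<open>\<delta>\<close>.\<close>

lemma abs_coefficient_le:
  fixes p p' w u E E' G G' l \<delta> :: real
  assumes eq: "w = E * u - E' * u + (G * p - G' * p')" and l: "0 < l"
    and lower: "\<delta> \<le> l * G" and d: "0 < \<delta>"
    and 1: "\<bar>l * (E - E')\<bar> \<le> d1" and 2: "\<bar>l * (G' - G)\<bar> \<le> d2"
  shows "\<delta> * \<bar>p - p'\<bar> \<le> \<bar>l * w\<bar> + d1 * \<bar>u\<bar> + d2 * \<bar>p'\<bar>"
proof -
  have "\<delta> * \<bar>p - p'\<bar> \<le> (l * G) * \<bar>p - p'\<bar>" using lower by (intro mult_right_mono) auto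
  also have "\<dots> = \<bar>l * G * (p - p')\<bar>" using lower d by (simp add: abs_mult[of "l * G"])
  also have "l * G * (p - p') = l * w - l * (E - E') * u + l * (G' - G) * p'"
    unfolding eq by (simp add: algebra_simps)
  also have "\<bar>\<dots>\<bar> \<le> \<bar>l * w\<bar> + \<bar>l * (E - E')\<bar> * \<bar>u\<bar> + \<bar>l * (G' - G)\<bar> * \<bar>p'\<bar>"
    unfolding abs_mult[symmetric] by linarith
  also have "\<dots> \<le> \<bar>l * w\<bar> + d1 * \<bar>u\<bar> + d2 * \<bar>p'\<bar>"
    using 1 2 by (intro add_mono mult_right_mono) auto
  finally show ?thesis .
qed

theorem mainTheorem6:
  fixes phi :: "nat \<Rightarrow> 'h::{real_inner,complete_space}"
    and lam :: "nat \<Rightarrow> real"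
    and a T0 cg M :: real
  assumes "spectral_data phi lam"
    and "0 < a" and "a < 1"
    and "0 < T0" and "0 < cg"
  shows "\<exists>c>0. \<forall>T T' g u0 psi psi'.
     T0 \<le> T \<longrightarrow> T < T' \<longrightarrow> C2_bounded T' M g \<longrightarrow> (\<forall>t\<in>{0..T'}. cg \<le> g t) \<longrightarrow>
     solP phi lam a u0 (\<lambda>s. g s *\<^sub>R psi) T - solP phi lam a u0 (\<lambda>s. g s *\<^sub>R psi') T' \<in> domA phi lam \<longrightarrow>
     norm (psi - psi') \<le> c * (norm (opA phi lam (solP phi lam a u0 (\<lambda>s. g s *\<^sub>R psi) T
                                              - solP phi lam a u0 (\<lambda>s. g s *\<^sub>R psi') T'))
                               + \<bar>T - T'\<bar> * T powr (-1 - a) * norm u0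
                               + \<bar>T - T'\<bar> * (1 + 1 / T + T) * norm psi')"
proof -
  note sd = assms(1) and a = assms(2,3)
  note on = spectral_dataD(1)[OF sd] and lam = spectral_dataD(3-5)[OF sd]
  have pars: "(norm v)\<^sup>2 = (\<Sum>n. (inner v (phi n))\<^sup>2)" for v
    using spectral_dataD(2)[OF sd] by (intro parseval on) blast
  note bess = bessel_summable[OF on]
  \<comment> \<open>Lower bound for \<open>lam n * G(T)\<close>, uniform in \<open>n\<close> and
    \<open>T \<ge> T0\<close>: \<open>ml_relax\<close> is largest at the smallest eigenvalue and
    earliest time.\<close>
  define \<delta> where "\<delta> = cg * (1 - ml_relax a (lam 0) T0)"
  \<comment> \<open>A common bound for all mode constants; the summand 1 lets \<open>K\<close> also
    be pulled out of the term with \<open>opA\<close>. The absolute value is taken because no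
    \<open>g\<close> forcing \<open>M \<ge> 0\<close> is fixed yet.\<close>
  define K where "K = 1 + 4 / Gamma (2 - a) + 2 * \<bar>M\<bar>"
  have G2: "0 < Gamma (2 - a)" using a by (intro Gamma_real_pos) auto
  have K: "1 \<le> K" "4 / Gamma (2 - a) \<le> K" "2 * \<bar>M\<bar> \<le> K" using G2 by (auto simp: K_def)
  have \<delta>: "0 < \<delta>"
    using mittag_leffler_one_less_one[OF a, of "lam 0 * T0 powr a"] assms(4,5) lam
    by (simp add: \<delta>_def ml_relax_def)
  show ?thesis
  \<comment> \<open>Squaring a sum of three terms costs a factor 3, rounded up to the perfect square
    4; hence the 2.\<close>
  proof (intro exI[of _ "2 * K / \<delta>"] conjI allI impI)
    show "0 < 2 * K / \<delta>" using K \<delta> by simp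
    fix T T' :: real and g u0 psi psi'
    assume T: "T0 \<le> T" "T < T'" and g: "C2_bounded T' M g" and cg: "\<forall>t\<in>{0..T'}. cg \<le> g t"
    define w where "w = solP phi lam a u0 (\<lambda>s. g s *\<^sub>R psi) T - solP phi lam a u0 (\<lambda>s. g s *\<^sub>R psi') T'"
    assume "solP phi lam a u0 (\<lambda>s. g s *\<^sub>R psi) T - solP phi lam a u0 (\<lambda>s. g s *\<^sub>R psi') T' \<in> domA phi lam"
    \<comment> \<open>Square summability is what allows the norm of the \<open>opA\<close> series to
      be computed from its coefficients.\<close>
    then have dom: "summable (\<lambda>n. (lam n * inner w (phi n))\<^sup>2)" by (simp add: domA_def w_def)
    define A B where "A = (T' - T) * T powr (-1 - a)" and "B = (T' - T) * (1 + 1 / T + T)"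
    have T0: "0 < T" using T assms(4) by simp
    have AB: "0 \<le> A" "0 \<le> B" using T T0 by (auto simp: A_def B_def)
    note gD = C2_boundedD[OF g]
    have gT: "continuous_on {0..T} g" using gD(1) T by (auto intro: continuous_on_subset)
    define X where "X = norm (opA phi lam w)"
    have X: "X\<^sup>2 = (\<Sum>n. (lam n * inner w (phi n))\<^sup>2)"
      unfolding X_def opA_def by (rule norm_suminf_orthonormal[OF on dom])
    have coeff: "\<delta> * \<bar>inner psi (phi n) - inner psi' (phi n)\<bar> \<le>
        \<bar>lam n * inner w (phi n)\<bar> + K * A * \<bar>inner u0 (phi n)\<bar> + K * B * \<bar>inner psi' (phi n)\<bar>" for n
    proof (rule abs_coefficient_le[OF _ lam(3)[of n] _ \<delta>])
      show "inner w (phi n) = ml_relax a (lam n) T * inner u0 (phi n) - ml_relax a (lam n) T' * inner u0 (phi n)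
         + (ml_duhamel a (lam n) g T * inner psi (phi n) - ml_duhamel a (lam n) g T' * inner psi' (phi n))"
      proof -
        have "inner (solP phi lam a u0 (\<lambda>s. g s *\<^sub>R psi) T) (phi n) =
            ml_relax a (lam n) T * inner u0 (phi n) + ml_duhamel a (lam n) g T * inner psi (phi n)"
          using T T0 gD(2) by (intro inner_solP[OF sd a _ gT, of M]) auto
        moreover have "inner (solP phi lam a u0 (\<lambda>s. g s *\<^sub>R psi') T') (phi n) =
            ml_relax a (lam n) T' * inner u0 (phi n) + ml_duhamel a (lam n) g T' * inner psi' (phi n)"
          using T T0 gD by (intro inner_solP[OF sd a, of T' g M]) auto
        ultimately show ?thesis by (simp add: w_def inner_diff_left)
      qed
      have "lam 0 * T0 powr a \<le> lam n * T powr a"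
        using a T assms(4) lam(1,2) lam(3)[of n] by (intro mult_mono powr_mono2) auto
      then have "\<delta> \<le> cg * (1 - ml_relax a (lam n) T)"
        unfolding \<delta>_def ml_relax_def
        using mittag_leffler_antimono[of a 1 "lam 0 * T0 powr a" "lam n * T powr a"] a assms(5) lam(1)
        by (intro mult_left_mono) auto
      also have "\<dots> \<le> lam n * ml_duhamel a (lam n) g T"
        using a lam T T0 gT cg by (intro ml_duhamel_lower_bound) auto
      finally show "\<delta> \<le> lam n * ml_duhamel a (lam n) g T" .
      note dec = ml_relax_decrement_bounds[OF a lam(3)[of n] T0 T(2)]
      have "\<bar>lam n * (ml_relax a (lam n) T - ml_relax a (lam n) T')\<bar> \<le> 4 / Gamma (2 - a) * A"
        using dec(1,3) lam(3)[of n] by (simp add: A_def abs_mult mult_ac)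
      also have "\<dots> \<le> K * A" using K AB by (intro mult_right_mono) auto
      finally show "\<bar>lam n * (ml_relax a (lam n) T - ml_relax a (lam n) T')\<bar> \<le> K * A" .
      have "\<bar>lam n * (ml_duhamel a (lam n) g T' - ml_duhamel a (lam n) g T)\<bar> \<le> (T' - T) * (M * (1 + 2 / T))"
        using gD by (intro ml_duhamel_increment a lam T0 T) auto
      also have "\<dots> \<le> (T' - T) * (2 * \<bar>M\<bar> * (1 + 1 / T + T))"
      proof -
        \<comment> \<open>Uses \<open>1 + 2 / T \<le> 2 * (1 + 1 / T + T)\<close>.\<close>
        have "M * (1 + 2 / T) \<le> \<bar>M\<bar> * (2 * (1 + 1 / T + T))"
          using T0 by (intro mult_mono) auto
        then show ?thesis using T by (intro mult_left_mono) (auto simp: mult_ac)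
      qed
      also have "\<dots> = 2 * \<bar>M\<bar> * B" by (simp add: B_def mult_ac)
      also have "\<dots> \<le> K * B" using K AB by (intro mult_right_mono) auto
      finally show "\<bar>lam n * (ml_duhamel a (lam n) g T' - ml_duhamel a (lam n) g T)\<bar> \<le> K * B" .
    qed
    define R where "R n = (lam n * inner w (phi n))\<^sup>2 + A\<^sup>2 * (inner u0 (phi n))\<^sup>2 + B\<^sup>2 * (inner psi' (phi n))\<^sup>2" for n
    have sq: "(inner (psi - psi') (phi n))\<^sup>2 \<le> 3 * (K / \<delta>)\<^sup>2 * R n" for n
    proof -
      define x y z where "x = \<bar>lam n * inner w (phi n)\<bar>" and "y = A * \<bar>inner u0 (phi n)\<bar>" and "z = B * \<bar>inner psi' (phi n)\<bar>"
      have xyz: "0 \<le> x" "0 \<le> y" "0 \<le> z" using AB by (auto simp: x_def y_def z_def)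
      have "\<delta> * \<bar>inner (psi - psi') (phi n)\<bar> \<le> x + K * y + K * z"
        using coeff[of n] by (simp add: x_def y_def z_def inner_diff_left mult.assoc)
      also have "\<dots> \<le> K * (x + y + z)"
        using mult_right_mono[OF K(1) xyz(1)] by (simp add: algebra_simps)
      finally have "\<bar>inner (psi - psi') (phi n)\<bar> \<le> K / \<delta> * (x + y + z)"
        using \<delta> by (simp add: field_simps)
      then have "(inner (psi - psi') (phi n))\<^sup>2 \<le> (K / \<delta> * (x + y + z))\<^sup>2"
        using power_mono[of "\<bar>inner (psi - psi') (phi n)\<bar>" _ 2] by simp
      also have "\<dots> \<le> (K / \<delta>)\<^sup>2 * (3 * (x\<^sup>2 + y\<^sup>2 + z\<^sup>2))"
      proof -
        have "3 * (x\<^sup>2 + y\<^sup>2 + z\<^sup>2) - (x + y + z)\<^sup>2 = (x - y)\<^sup>2 + (y - z)\<^sup>2 + (x - z)\<^sup>2"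
          by (simp add: power2_eq_square algebra_simps)
        moreover have "0 \<le> (x - y)\<^sup>2 + (y - z)\<^sup>2 + (x - z)\<^sup>2" by simp
        ultimately have "(x + y + z)\<^sup>2 \<le> 3 * (x\<^sup>2 + y\<^sup>2 + z\<^sup>2)" by linarith
        then show ?thesis unfolding power_mult_distrib by (intro mult_left_mono) auto
      qed
      also have "x\<^sup>2 + y\<^sup>2 + z\<^sup>2 = R n"
        by (simp add: x_def y_def z_def R_def power_mult_distrib)
      finally show ?thesis by (simp add: mult_ac)
    qed
    have R: "R sums (X\<^sup>2 + A\<^sup>2 * (norm u0)\<^sup>2 + B\<^sup>2 * (norm psi')\<^sup>2)"
      unfolding R_def X pars[of u0] pars[of psi']
      by (intro sums_add sums_mult summable_sums dom bess)
    have "(norm (psi - psi'))\<^sup>2 \<le> (\<Sum>n. 3 * (K / \<delta>)\<^sup>2 * R n)"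
      unfolding pars[of "psi - psi'"]
      by (intro suminf_le sq bess summable_mult sums_summable[OF R])
    also have "\<dots> = 3 * (K / \<delta>)\<^sup>2 * (X\<^sup>2 + (A * norm u0)\<^sup>2 + (B * norm psi')\<^sup>2)"
      using sums_mult[OF R, of "3 * (K / \<delta>)\<^sup>2"] by (simp add: sums_iff power_mult_distrib)
    \<comment> \<open>The cross terms of the square are nonnegative, so the sum of squares is at
      most the square of the sum.\<close>
    also have "\<dots> \<le> 4 * (K / \<delta>)\<^sup>2 * (X + A * norm u0 + B * norm psi')\<^sup>2"
    proof (intro mult_mono)
      have nn: "0 \<le> X" "0 \<le> A * norm u0" "0 \<le> B * norm psi'" using AB by (auto simp: X_def)
      have "X\<^sup>2 + y\<^sup>2 + z\<^sup>2 \<le> (X + y + z)\<^sup>2" if "0 \<le> y" "0 \<le> z" for y z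
        using that nn(1) by (simp add: power2_eq_square algebra_simps)
      then show "X\<^sup>2 + (A * norm u0)\<^sup>2 + (B * norm psi')\<^sup>2 \<le> (X + A * norm u0 + B * norm psi')\<^sup>2"
        using nn by blast
    qed auto
    also have "\<dots> = (2 * K / \<delta> * (X + A * norm u0 + B * norm psi'))\<^sup>2"
      by (simp add: power_mult_distrib power_divide)
    finally have "norm (psi - psi') \<le> 2 * K / \<delta> * (X + A * norm u0 + B * norm psi')"
      by (rule power2_le_imp_le) (use K \<delta> AB in \<open>auto simp: X_def intro!: mult_nonneg_nonneg add_nonneg_nonneg\<close>)
    then show "norm (psi - psi') \<le> 2 * K / \<delta> * (norm (opA phi lam (solP phi lam a u0 (\<lambda>s. g s *\<^sub>R psi) T
                                              - solP phi lam a u0 (\<lambda>s. g s *\<^sub>R psi') T'))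
                               + \<bar>T - T'\<bar> * T powr (-1 - a) * norm u0
                               + \<bar>T - T'\<bar> * (1 + 1 / T + T) * norm psi')"
      using T by (simp add: X_def w_def A_def B_def)
  qed
qed

end
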